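(* There is no finite set $A \subseteq \mathbb{Z}$ with $|A|=7$ and $|A+A|>|A-A|$. Moreover, if $A\subseteq\mathbb{Z}$ satisfies $|A|=8$ and $|A+A|>|A-A|$, then there exist integers $u\neq 0$ and $v$ such that $A=\{ua+v : a\in A_1\}$, where $A_1=\{0,2,3,4,7,11,12,14\}$.
   Context: For $A\subseteq\mathbb{Z}$, $A+A=\{a_1+a_2 : a_1,a_2\in A\}$ and $A-A=\{a_1-a_2 : a_1,a_2\in A\}$. A finite set $A$ with $|A+A|>|A-A|$ is called an MSTD (more sums than differences) set; the set $A_1$ satisfies this. *)

theory Defs
  imports Main "HOL-Library.Set_Algebras"
begin

(* The sumset is the library's pointwise A + B on sets. The operator - on sets
   is set-theoretic difference, so the difference set needs its own constant. *)

definition diffset :: "int set \<Rightarrow> int set \<Rightarrow> int set" where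
  "diffset A B = {a - b | a b. a \<in> A \<and> b \<in> B}"

definition MSTD :: "int set \<Rightarrow> bool" where
  "MSTD A \<longleftrightarrow> finite A \<and> card (A + A) > card (diffset A A)"

definition A1 :: "int set" where
  "A1 = {0, 2, 3, 4, 7, 11, 12, 14}"

end

theory Submission
  imports Defs Complex_Main
begin

text \<open>
  Sort a finite set of reals and subtract its minimum. The tuples obtained in this way and
  satisfying a given system of coincidences \<open>p + q = r + s\<close> are the inner points of a polyhedral
  cone, on whose extreme rays the elements of the set become integer vectors. Signs of linear
  forms on the cone can be read off these vectors.

  An MSTD set must satisfy many coincidences. If its minimum (or maximum) is deleted and the rest
  is not MSTD, then the deleted element contributes more new sums than new differences; moreover
  \<open>2 D + 2 \<le> card (A + A)\<close> where \<open>D\<close> is the number of positive differences. As long as too many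
  differences are known to be distinct, each of the two constraints yields a finite list of linear
  equations one of which has to hold. Branching over this list, and remembering the equations that
  were excluded before, leads after a few steps to cones of dimension one, and the only survivors
  are the given set \<open>A1\<close> and its mirror image, for eight elements.
\<close>

subsection \<open>Sum and difference sets\<close>

text \<open>The elements of an MSTD set are not bounded in advance, so sets cannot be enumerated;
  the tree of coincidences is finite. Every candidate equation is a form with both signs on the
  rays, so it is not identically zero and imposing it lowers the dimension of the cone. From the
  seven gaps of an eight-element set, six equations lead to a single ray, that is, to one set up to
  translation and scaling. Deleting an end is informative only if the remaining set is known not to
  be MSTD. This forces the order of the proof: size one directly, then sizes two to seven by the
  search, and eight last. Reflection turns deletion of the maximum into deletion of the minimum and
  gives a second constraint; the count of all differences is the fallback when neither end gives
  one. Real sets are used because points of a cone are combinations of rays whose weights arise by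
  division; integrality is recovered at the very end.\<close>

definition differences :: "'a::ab_group_add set \<Rightarrow> 'a set" where
  "differences A = (\<lambda>(a, b). a - b) ` (A \<times> A)"

definition mstd :: "'a::ab_group_add set \<Rightarrow> bool" where
  "mstd A \<longleftrightarrow> finite A \<and> card (differences A) < card (A + A)"

lemma differences_iff: "d \<in> differences A \<longleftrightarrow> (\<exists>a\<in>A. \<exists>b\<in>A. d = a - b)"
  by (auto simp: differences_def)

lemma uminus_differences: "d \<in> differences A \<Longrightarrow> - d \<in> differences A"
  unfolding differences_iff by (metis minus_diff_eq)

lemma finite_differences: "finite A \<Longrightarrow> finite (differences A)"
  by (simp add: differences_def)

lemma pair_image: "(\<lambda>(x, y). h x y) ` (f ` A \<times> f ` A) = (\<lambda>(x, y). h (f x) (f y)) ` (A \<times> A)"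
  by force

lemma sumset_translate:
  fixes A :: "'a::ab_group_add set"
  shows "(+) t ` A + (+) t ` A = (+) (t + t) ` (A + A)"
  unfolding set_plus_image pair_image image_image
  by (intro image_cong) (auto simp: algebra_simps)

lemma differences_translate: "differences ((+) t ` A) = differences A"
  unfolding differences_def pair_image by (intro image_cong) auto

lemma card_translate: "card ((+) (t :: 'a::ab_group_add) ` A) = card A"
  by (rule card_image) (simp add: inj_on_def)

lemma mstd_translate: "mstd ((+) t ` A) \<longleftrightarrow> mstd (A :: 'a::ab_group_add set)"
  by (simp add: mstd_def sumset_translate differences_translate card_translate finite_image_iff)

lemma sumset_uminus: "uminus ` A + uminus ` A = uminus ` (A + A :: 'a::ab_group_add set)"
  unfolding set_plus_image pair_image image_image by (intro image_cong) auto

lemma differences_uminus: "differences (uminus ` A) = differences (A :: 'a::ab_group_add set)"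
proof -
  have "differences (uminus ` A) \<subseteq> differences A" for A :: "'a set"
    unfolding differences_def pair_image by (auto simp: image_iff)
  from this[of A] this[of "uminus ` A"] show ?thesis
    by (simp add: image_image)
qed

lemma mstd_uminus: "mstd (uminus ` A) \<longleftrightarrow> mstd (A :: 'a::ab_group_add set)"
  by (simp add: mstd_def sumset_uminus differences_uminus card_image finite_image_iff)

lemma mstd_reflect: "mstd ((\<lambda>a. t - a) ` A) \<longleftrightarrow> mstd (A :: 'a::ab_group_add set)"
proof -
  have "(\<lambda>a. t - a) ` A = (+) t ` uminus ` A"
    by (simp add: image_image)
  then show ?thesis
    by (simp only: mstd_translate mstd_uminus)
qed

section \<open>Cost of a new minimum, in sums and in differences\<close>

text \<open>The only sums that can be new are 0 + 0 and 0 + b, and for b in \<open>Y\<close> the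
  latter is old.\<close>

lemma card_sumset_insert_le:
  fixes B :: "real set"
  assumes "finite B" "0 \<notin> B" "Y \<subseteq> B" and Y: "\<And>y. y \<in> Y \<Longrightarrow> \<exists>b\<in>B. \<exists>c\<in>B. y = b + c"
  shows "card (insert 0 B + insert 0 B) + card Y \<le> card (B + B) + card B + 1"
proof -
  have "insert 0 B + insert 0 B \<subseteq> (B + B) \<union> insert 0 (B - Y)"
  proof
    fix s assume "s \<in> insert 0 B + insert 0 B"
    then obtain a b where s: "s = a + b" "a \<in> insert 0 B" "b \<in> insert 0 B"
      by (rule set_plus_elim)
    show "s \<in> (B + B) \<union> insert 0 (B - Y)"
    proof (cases "a \<in> B \<and> b \<in> B")
      case True
      then show ?thesis using s by (auto intro: set_plus_intro)
    next
      case False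
      then have "s \<in> insert 0 B" using s by auto
      moreover have "s \<in> B + B" if "s \<in> Y" using Y[OF that] by (auto intro: set_plus_intro)
      ultimately show ?thesis by auto
    qed
  qed
  then have "card (insert 0 B + insert 0 B) \<le> card ((B + B) \<union> insert 0 (B - Y))"
    using assms by (intro card_mono) (auto simp: finite_set_plus)
  also have "\<dots> \<le> card (B + B) + card (insert 0 (B - Y))"
    by (rule card_Un_le)
  also have "card (insert 0 (B - Y)) = Suc (card B - card Y)"
    using assms by (simp add: card_Diff_subset finite_subset)
  finally show ?thesis
    using card_mono[of B Y] assms by simp
qed

text \<open>\<open>D\<close>, \<open>C\<close> and the negatives of \<open>C\<close> are pairwise
  disjoint. Used with \<open>D\<close> the differences of the set without its minimum, and with
  \<open>D\<close> consisting of 0 only.\<close>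

lemma two_card_le_card_differences:
  fixes A :: "real set"
  assumes "finite A" "C \<subseteq> differences A" "D \<subseteq> differences A" "\<And>c. c \<in> C \<Longrightarrow> 0 < c \<and> c \<notin> D"
    "\<And>d. d \<in> D \<Longrightarrow> - d \<in> D"
  shows "card D + 2 * card C \<le> card (differences A)"
proof -
  have fin: "finite C" "finite D"
    using assms finite_differences finite_subset by blast+
  have "card (D \<union> C \<union> uminus ` C) = card D + card C + card (uminus ` C)"
  proof (subst card_Un_disjoint)
    show "(D \<union> C) \<inter> uminus ` C = {}"
    proof (rule ccontr)
      assume "\<not> ?thesis"
      then obtain c where c: "c \<in> C" "- c \<in> D \<or> - c \<in> C"
        by blast
      then have "- c \<notin> C"
        using assms(4)[of c] assms(4)[of "- c"] by linarith
      then show False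
        using c assms(4)[of c] assms(5)[of "- c"] by simp
    qed
    show "card (D \<union> C) + card (uminus ` C) = card D + card C + card (uminus ` C)"
      using card_Un_disjoint[of D C] assms(4) fin by auto
  qed (use fin in simp_all)
  also have "card (uminus ` C) = card C"
    by (simp add: card_image)
  finally have "card D + 2 * card C = card (D \<union> C \<union> uminus ` C)"
    by simp
  also have "\<dots> \<le> card (differences A)"
    using assms by (intro card_mono) (auto simp: finite_differences intro: uminus_differences)
  finally show ?thesis .
qed

text \<open>If no element of \<open>C\<close> were a difference within \<open>B\<close>, each would
  bring itself and its negative as new differences. This gain of 2 |C| is at least the gain |B| + 1
  - |Y| in sums, so the excess of sums over differences would already be present in
  \<open>B\<close>.\<close>

lemma end_coincidence:
  fixes B :: "real set"
  assumes fin: "finite B" and pos: "\<And>b. b \<in> B \<Longrightarrow> 0 < b"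
    and A: "mstd (insert 0 B)" and B: "\<not> mstd B"
    and Y: "Y \<subseteq> B" "\<And>y. y \<in> Y \<Longrightarrow> \<exists>b\<in>B. \<exists>c\<in>B. y = b + c"
    and C: "C \<subseteq> B" and le: "card B + 1 \<le> card Y + 2 * card C"
  shows "\<exists>b\<in>C. \<exists>y\<in>B. \<exists>c\<in>B. y = b + c"
proof (rule ccontr)
  assume neg: "\<not> ?thesis"
  have "card (differences B) + 2 * card C \<le> card (differences (insert 0 B))"
  proof (rule two_card_le_card_differences)
    show "finite (insert 0 B)" using fin by simp
    show "C \<subseteq> differences (insert 0 B)"
      using C by (force simp: differences_iff)
    show "differences B \<subseteq> differences (insert 0 B)"
      unfolding differences_def by (intro image_mono) auto
    show "0 < c \<and> c \<notin> differences B" if c: "c \<in> C" for c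
    proof -
      have "c \<notin> differences B"
      proof
        assume "c \<in> differences B"
        then obtain y b where "y \<in> B" "b \<in> B" "y = c + b"
          by (force simp: differences_iff)
        then show False
          using neg c by blast
      qed
      then show ?thesis
        using c C pos by auto
    qed
    show "- d \<in> differences B" if "d \<in> differences B" for d
      using that by (rule uminus_differences)
  qed
  moreover have "card (insert 0 B + insert 0 B) + card Y \<le> card (B + B) + card B + 1"
    using pos Y fin by (intro card_sumset_insert_le) auto
  moreover have "card (B + B) \<le> card (differences B)" "card (differences (insert 0 B)) < card (insert 0 B + insert 0 B)"
    using A B fin by (auto simp: mstd_def)
  ultimately show False
    using le by linarith
qed

text \<open>0, \<open>C\<close> and the negatives of \<open>C\<close> alone are 2 |C| + 1
  differences.\<close>

lemma all_coincidence:
  fixes A :: "real set"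
  assumes "mstd A" "A \<noteq> {}" "C \<subseteq> differences A" "\<And>c. c \<in> C \<Longrightarrow> 0 < c" "card (A + A) \<le> 2 * card C + 1"
  shows False
proof -
  have "card {0::real} + 2 * card C \<le> card (differences A)"
    using assms by (intro two_card_le_card_differences) (auto simp: mstd_def differences_iff)
  then show False
    using assms by (auto simp: mstd_def)
qed

subsection \<open>The search\<close>

text \<open>
  A \<open>vec\<close> is a linear form on the current cone, given by its values on the extreme rays. The search
  works on a list \<open>W\<close> of such forms, one for each element of the set other than the minimum (which
  is \<open>0\<close>), in decreasing order, and on a list \<open>ns\<close> of forms that are known not to vanish.
\<close>

type_synonym vec = "int list"

datatype order = Equal | Less | Greater | Mixed

text \<open>Bits are read from the lowest upwards; \<open>c\<close> is the verdict of the bits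
  already read, which a higher differing bit overrides.\<close>

fun num_cmp :: "order \<Rightarrow> num \<Rightarrow> num \<Rightarrow> order" where
  "num_cmp c num.One num.One = c"
| "num_cmp c num.One (num.Bit0 n) = Less"
| "num_cmp c num.One (num.Bit1 n) = Less"
| "num_cmp c (num.Bit0 m) num.One = Greater"
| "num_cmp c (num.Bit1 m) num.One = Greater"
| "num_cmp c (num.Bit0 m) (num.Bit0 n) = num_cmp c m n"
| "num_cmp c (num.Bit1 m) (num.Bit1 n) = num_cmp c m n"
| "num_cmp c (num.Bit0 m) (num.Bit1 n) = num_cmp Less m n"
| "num_cmp c (num.Bit1 m) (num.Bit0 n) = num_cmp Greater m n"

lemma num_cmp_eq: "num_cmp c m n = (if m < n then Less else if n < m then Greater else c)"
  by (induction c m n rule: num_cmp.induct)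
    (auto simp: less_num_simps le_num_simps not_less order.order_iff_strict)

definition int_cmp :: "int \<Rightarrow> int \<Rightarrow> order" where
  "int_cmp x y = (if x < y then Less else if y < x then Greater else Equal)"

text \<open>Accumulates the comparison over the rays. \<open>Less\<close> stands for \<le> on all
  rays with at least one strict, which is decisive at inner points because all weights are positive
  there; \<open>Mixed\<close> leaves the sign open.\<close>

fun join :: "order \<Rightarrow> order \<Rightarrow> order" where
  "join Equal y = y"
| "join Less Equal = Less"
| "join Less Less = Less"
| "join Less _ = Mixed"
| "join Greater Equal = Greater"
| "join Greater Greater = Greater"
| "join Greater _ = Mixed"
| "join Mixed _ = Mixed"

fun vcmp :: "order \<Rightarrow> vec \<Rightarrow> vec \<Rightarrow> order" where
  "vcmp c (x # xs) (y # ys) =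
    (let c' = join c (int_cmp x y) in if c' = Mixed then Mixed else vcmp c' xs ys)"
| "vcmp c _ _ = c"

fun vsub :: "vec \<Rightarrow> vec \<Rightarrow> vec" where
  "vsub (x # xs) (y # ys) = (x - y) # vsub xs ys"
| "vsub _ _ = []"

fun leading_pos :: "vec \<Rightarrow> bool" where
  "leading_pos [] = True"
| "leading_pos (x # xs) = (if x = 0 then leading_pos xs else 0 < x)"

primrec vneg :: "vec \<Rightarrow> vec" where
  "vneg [] = []"
| "vneg (x # xs) = - x # vneg xs"

text \<open>A form and its negative define the same hyperplane; fixing the sign of the first nonzero
  entry lets \<open>dedup\<close> recognise this.\<close>

definition vnorm :: "vec \<Rightarrow> vec" where
  "vnorm v = (if leading_pos v then v else vneg v)"

section \<open>Lists of equations one of which must hold\<close>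

text \<open>
  \<open>scan v ws ds\<close> adds to \<open>ds\<close> the forms \<open>v - w\<close> that may vanish, and is \<open>None\<close> if \<open>v\<close> equals some
  \<open>w\<close> identically. As \<open>ws\<close> is decreasing, it can stop at the first \<open>w\<close> below \<open>v\<close>.
\<close>

primrec scan :: "vec \<Rightarrow> vec list \<Rightarrow> vec list \<Rightarrow> vec list option" where
  "scan v [] ds = Some ds"
| "scan v (w # ws) ds =
    (case vcmp Equal v w of
      Equal \<Rightarrow> None
    | Greater \<Rightarrow> Some ds
    | Less \<Rightarrow> scan v ws ds
    | Mixed \<Rightarrow> scan v ws (vnorm (vsub v w) # ds))"

text \<open>
  For \<open>b = W ! n\<close> this compares \<open>y - b\<close> with all \<open>c\<close>, where \<open>y\<close> is one of the \<open>n\<close> elements above \<open>b\<close>: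
  it decides whether the difference \<open>b - 0\<close> already occurs as \<open>y - c\<close> when the minimum is deleted.
\<close>

fun scan_old :: "nat \<Rightarrow> vec \<Rightarrow> vec list \<Rightarrow> vec list \<Rightarrow> vec list option" where
  "scan_old (Suc n) b (y # ys) ds =
    (case scan (vsub y b) ys ds of None \<Rightarrow> None | Some ds' \<Rightarrow> scan_old n b ys ds')"
| "scan_old _ b _ ds = Some ds"

text \<open>Looks for \<open>m\<close> elements that are not identically old differences. The
  largest come first, since few elements lie above them and they produce few equations.
  \<open>None\<close> means that too few exist, so the constraint gives nothing.\<close>

primrec end_select :: "vec list \<Rightarrow> vec list \<Rightarrow> nat \<Rightarrow> nat \<Rightarrow> vec list \<Rightarrow> vec list option" where
  "end_select W [] n m ds = (case m of 0 \<Rightarrow> Some ds | Suc k \<Rightarrow> None)"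
| "end_select W (b # bs) n m ds =
    (case m of
      0 \<Rightarrow> Some ds
    | Suc k \<Rightarrow>
      (case scan_old n b W ds of
        None \<Rightarrow> end_select W bs (Suc n) (Suc k) ds
      | Some ds' \<Rightarrow> end_select W bs (Suc n) k ds'))"

primrec vmem :: "vec \<Rightarrow> vec list \<Rightarrow> bool" where
  "vmem v [] = False"
| "vmem v (w # ws) = (v = w \<or> vmem v ws)"

primrec is_sum :: "vec \<Rightarrow> vec list \<Rightarrow> bool" where
  "is_sum y [] = False"
| "is_sum y (b # bs) = (vmem (vsub y b) (b # bs) \<or> is_sum y bs)"

text \<open>The starting value 1 counts 0 + 0. A positive element can only be a sum of smaller ones,
  so testing against the tail is enough.\<close>

primrec new_sums :: "vec list \<Rightarrow> nat" where
  "new_sums [] = 1"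
| "new_sums (y # ys) = (if is_sum y ys then new_sums ys else Suc (new_sums ys))"

text \<open>
  If \<open>s\<close> is the number of new sums, fewer than \<open>s / 2\<close> positive differences can be new, so that one
  of any \<open>(s + 1) div 2\<close> differences must be old.
\<close>

definition end_cands :: "vec list \<Rightarrow> vec list option" where
  "end_cands W = end_select W W 0 (Suc (new_sums W) div 2) []"

text \<open>The set reflected by a \<mapsto> t - a with t its maximum: 0 becomes t, t becomes 0, and
  reversing the rest restores the decreasing order.\<close>

fun mirror :: "vec list \<Rightarrow> vec list" where
  "mirror [] = []"
| "mirror (t # ws) = t # map (vsub t) (rev ws)"

primrec translate :: "vec \<Rightarrow> vec list \<Rightarrow> vec list" where
  "translate p [] = []"
| "translate p (q # qs) = vsub q p # translate p qs"

lemma length_translate [simp]: "length (translate p qs) = length qs"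
  by (induction qs) auto

definition rebase :: "vec list \<Rightarrow> vec list" where
  "rebase W = translate (last W) (butlast W)"

text \<open>Removes minima one by one and adds up the bounds on the sums each contributes. The base
  value 1 is the sumset of a single point.\<close>

function sum_bound :: "vec list \<Rightarrow> nat" where
  "sum_bound W = (if W = [] then 1 else new_sums W + sum_bound (rebase W))"
  by auto
termination
  by (relation "measure length") (auto simp: rebase_def)

declare sum_bound.simps [simp del]

primrec scan_rows :: "vec \<Rightarrow> vec list list \<Rightarrow> vec list \<Rightarrow> vec list option" where
  "scan_rows v [] ds = Some ds"
| "scan_rows v (r # rs) ds =
    (case scan v r ds of None \<Rightarrow> None | Some ds' \<Rightarrow> scan_rows v rs ds')"

primrec row_select :: "vec list list \<Rightarrow> vec list \<Rightarrow> nat \<Rightarrow> vec list \<Rightarrow> nat \<times> vec list" where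
  "row_select rows [] m ds = (m, ds)"
| "row_select rows (v # vs) m ds =
    (case m of
      0 \<Rightarrow> (0, ds)
    | Suc k \<Rightarrow>
      (case scan_rows v rows ds of
        None \<Rightarrow> row_select rows vs (Suc k) ds
      | Some ds' \<Rightarrow> row_select rows vs k ds'))"

text \<open>Works through the triangle of positive differences: each row holds the differences to
  one fixed element, starting with the minimum. Entries of one row are distinct, so an entry has to
  be compared with earlier rows only.\<close>

function all_select :: "vec list list \<Rightarrow> vec list \<Rightarrow> nat \<Rightarrow> vec list \<Rightarrow> vec list option" where
  "all_select rows W m ds =
    (if W = [] then None
     else case row_select rows W m ds of
       (m', ds') \<Rightarrow> if m' = 0 then Some ds' else all_select (W # rows) (rebase W) m' ds')"
  by auto
termination
  by (relation "measure (\<lambda>(rows, W, m, ds). length W)") (auto simp: rebase_def)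

declare all_select.simps [simp del]

text \<open>With s = \<open>sum_bound W\<close>, s div 2 distinct positive differences, their
  negatives and 0 are already at least s differences.\<close>

definition all_cands :: "vec list \<Rightarrow> vec list option" where
  "all_cands W = all_select [] W (sum_bound W div 2) []"

primrec dedup :: "vec list \<Rightarrow> vec list \<Rightarrow> vec list \<Rightarrow> vec list" where
  "dedup ns [] out = out"
| "dedup ns (d # ds) out =
    (if vmem d ns then dedup ns ds out
     else if vmem d out then dedup ns ds out else dedup ns ds (d # out))"

definition reduced :: "vec list \<Rightarrow> vec list option \<Rightarrow> vec list option" where
  "reduced ns c = map_option (\<lambda>ds. dedup ns ds []) c"

text \<open>Compares lengths without computing them, in a form suited to rewriting.\<close>

fun shorter :: "'a list \<Rightarrow> 'a list \<Rightarrow> bool" where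
  "shorter [] ys = True"
| "shorter (x # xs) [] = False"
| "shorter (x # xs) (y # ys) = shorter xs ys"

definition better :: "vec list \<Rightarrow> vec list option \<Rightarrow> vec list" where
  "better ds c = (case c of None \<Rightarrow> ds | Some ds' \<Rightarrow> if shorter ds ds' then ds else ds')"

text \<open>The test against \<open>[[]]\<close> asks for at most one equation; then the upper end
  is not examined. Otherwise the shorter of the two lists is taken. A final \<open>None\<close>
  means that no constraint is available, and the search then insists on a terminal set.\<close>

definition branch :: "vec list \<Rightarrow> vec list \<Rightarrow> vec list option" where
  "branch W ns =
    (case reduced ns (end_cands W) of
      None \<Rightarrow>
        (case reduced ns (end_cands (mirror W)) of
          None \<Rightarrow> reduced ns (all_cands W)
        | Some ds \<Rightarrow> Some ds)
    | Some ds \<Rightarrow>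
        Some (if shorter ds [[]] then ds else better ds (reduced ns (end_cands (mirror W)))))"

section \<open>Hyperplane sections of the cone\<close>

text \<open>
  Intersecting the cone with the hyperplane \<open>d = 0\<close> is one step of the double description method:
  rays on the hyperplane are kept, rays on opposite sides are combined in pairs, and among these
  only the ones with minimal support are extreme. The support is recorded by a pattern that marks
  the pairs of consecutive elements which coincide on the ray.
\<close>

datatype ray = Old nat | Sum nat nat | Comb nat int nat int

fun eq_cols :: "vec \<Rightarrow> vec \<Rightarrow> bool list list \<Rightarrow> bool list list" where
  "eq_cols (x # xs) (y # ys) (p # ps) = ((x = y) # p) # eq_cols xs ys ps"
| "eq_cols _ _ _ = []"

fun patterns :: "vec list \<Rightarrow> bool list list" where
  "patterns (v # w # ws) = eq_cols v w (patterns (w # ws))"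
| "patterns [v] = map (\<lambda>_. []) v"
| "patterns [] = []"

fun split_rays :: "nat \<Rightarrow> vec \<Rightarrow> bool list list \<Rightarrow> (bool list \<times> ray) list \<Rightarrow>
    (bool list \<times> nat \<times> int) list \<Rightarrow> (bool list \<times> nat \<times> int) list \<Rightarrow>
    (bool list \<times> ray) list \<times> (bool list \<times> nat \<times> int) list \<times> (bool list \<times> nat \<times> int) list" where
  "split_rays i (x # xs) (p # ps) zs us vs =
    (if x = 0 then split_rays (Suc i) xs ps ((p, Old i) # zs) us vs
     else if 0 < x then split_rays (Suc i) xs ps zs ((p, i, x) # us) vs
     else split_rays (Suc i) xs ps zs us ((p, i, - x) # vs))"
| "split_rays i _ _ zs us vs = (zs, us, vs)"

fun band :: "bool list \<Rightarrow> bool list \<Rightarrow> bool list" where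
  "band (x # xs) (y # ys) = (x \<and> y) # band xs ys"
| "band _ _ = []"

text \<open>Any positive multiple represents the same ray, so equal weights are replaced by 1 to
  keep the integers small.\<close>

definition mk_ray :: "nat \<Rightarrow> int \<Rightarrow> nat \<Rightarrow> int \<Rightarrow> ray" where
  "mk_ray i x j y = (if x = y then Sum i j else Comb i x j y)"

text \<open>The form has value \<open>x\<close> on ray \<open>i\<close> and \<open>- y\<close> on
  ray \<open>j\<close>; the crossed weights \<open>y\<close> and \<open>x\<close> make it vanish on
  the combination.\<close>

fun combine1 :: "bool list \<Rightarrow> nat \<Rightarrow> int \<Rightarrow> (bool list \<times> nat \<times> int) list \<Rightarrow> (bool list \<times> ray) list \<Rightarrow>
    (bool list \<times> ray) list" where
  "combine1 p i x [] zs = zs"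
| "combine1 p i x ((q, j, y) # vs) zs = combine1 p i x vs ((band p q, mk_ray i y j x) # zs)"

fun combine :: "(bool list \<times> nat \<times> int) list \<Rightarrow> (bool list \<times> nat \<times> int) list \<Rightarrow> (bool list \<times> ray) list \<Rightarrow>
    (bool list \<times> ray) list" where
  "combine [] vs zs = zs"
| "combine ((p, i, x) # us) vs zs = combine us vs (combine1 p i x vs zs)"

fun covers :: "bool list \<Rightarrow> bool list \<Rightarrow> bool" where
  "covers (x # xs) (y # ys) = ((y \<longrightarrow> x) \<and> covers xs ys)"
| "covers _ _ = True"

fun any_covers :: "bool list \<Rightarrow> (bool list \<times> ray) list \<Rightarrow> bool" where
  "any_covers p [] = False"
| "any_covers p ((q, e) # es) = (covers q p \<or> any_covers p es)"

fun drop_covered :: "bool list \<Rightarrow> (bool list \<times> ray) list \<Rightarrow> (bool list \<times> ray) list" where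
  "drop_covered p [] = []"
| "drop_covered p ((q, e) # es) =
    (if covers p q then drop_covered p es else (q, e) # drop_covered p es)"

text \<open>More marks in a pattern mean a smaller support, so covered patterns are the ones to
  discard. Equal patterns cover each other, hence only one ray of each pattern survives.\<close>

fun extreme :: "(bool list \<times> ray) list \<Rightarrow> (bool list \<times> ray) list \<Rightarrow> (bool list \<times> ray) list" where
  "extreme ks [] = ks"
| "extreme ks ((p, e) # es) =
    (if any_covers p ks then extreme ks es else extreme ((p, e) # drop_covered p ks) es)"

text \<open>A mark shared by all rays makes two neighbouring elements coincide on the whole section,
  which then contains no admissible set. The same test rejects a section without rays.\<close>

fun common_zeros :: "bool list \<Rightarrow> (bool list \<times> ray) list \<Rightarrow> bool list" where
  "common_zeros p [] = p"
| "common_zeros p ((q, e) # es) = common_zeros (band p q) es"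

primrec none_true :: "bool list \<Rightarrow> bool" where
  "none_true [] = True"
| "none_true (x # xs) = (\<not> x \<and> none_true xs)"

fun ray_entry :: "ray \<Rightarrow> vec \<Rightarrow> int" where
  "ray_entry (Old i) v = v ! i"
| "ray_entry (Sum i j) v = v ! i + v ! j"
| "ray_entry (Comb i x j y) v = x * v ! i + y * v ! j"

fun project :: "(bool list \<times> ray) list \<Rightarrow> vec \<Rightarrow> vec" where
  "project [] v = []"
| "project ((p, e) # es) v = ray_entry e v # project es v"

primrec project_all :: "(bool list \<times> ray) list \<Rightarrow> vec list \<Rightarrow> vec list" where
  "project_all es [] = []"
| "project_all es (v # vs) = project es v # project_all es vs"

fun vsgn :: "order \<Rightarrow> vec \<Rightarrow> order" where
  "vsgn c [] = c"
| "vsgn c (x # xs) =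
    (let c' = join c (int_cmp x 0) in if c' = Mixed then Mixed else vsgn c' xs)"

text \<open>An excluded form that vanishes identically on the section kills the branch. One of
  constant sign cannot vanish at inner points and carries no more information; only forms of mixed
  sign are remembered.\<close>

primrec clean :: "vec list \<Rightarrow> vec list \<Rightarrow> vec list option" where
  "clean [] out = Some out"
| "clean (v # vs) out =
    (case vsgn Equal v of
      Equal \<Rightarrow> None
    | Mixed \<Rightarrow> clean vs (vnorm v # out)
    | Less \<Rightarrow> clean vs out
    | Greater \<Rightarrow> clean vs out)"

definition rays :: "vec \<Rightarrow> vec list \<Rightarrow> (bool list \<times> ray) list" where
  "rays d W =
    (case split_rays 0 d (patterns (W @ [map (\<lambda>_. 0) d])) [] [] [] of
      (zs, us, vs) \<Rightarrow> extreme [] (combine us vs zs))"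

definition restrict :: "vec \<Rightarrow> vec list \<Rightarrow> vec list \<Rightarrow> (vec list \<times> vec list) option" where
  "restrict d W ns =
    (let es = rays d W in
      if none_true (common_zeros (map (\<lambda>_. True) W) es)
      then map_option (Pair (project_all es W)) (clean (project_all es ns) [])
      else None)"

section \<open>Leaves and recursion of the search\<close>

fun scale :: "int \<Rightarrow> vec \<Rightarrow> vec" where
  "scale c [] = []"
| "scale c (x # xs) = c * x # scale c xs"

text \<open>On a cone with one ray every form is a single number. Stopping at the first other vector
  leaves a list too short for \<open>terminal\<close> when \<open>W\<close> has seven entries. There
  proportionality is tested by cross multiplication with the largest entry 14.\<close>

fun scalars :: "vec list \<Rightarrow> vec" where
  "scalars [] = []"
| "scalars ([x] # W) = x # scalars W"
| "scalars (_ # W) = []"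

text \<open>The two lists are the nonzero elements of \<open>A1\<close> and of \<open>14 - A1\<close>.\<close>

definition terminal :: "vec list \<Rightarrow> bool" where
  "terminal W =
    (case scalars W of
      [] \<Rightarrow> False
    | x # xs \<Rightarrow>
        scale 14 (x # xs) = scale x [14, 12, 11, 7, 4, 3, 2] \<or>
        scale 14 (x # xs) = scale x [14, 12, 11, 10, 7, 3, 2])"

fun search_all :: "(vec list \<Rightarrow> vec list \<Rightarrow> bool) \<Rightarrow> vec list \<Rightarrow> vec list \<Rightarrow> vec list \<Rightarrow> bool" where
  "search_all f W [] ns = True"
| "search_all f W (d # ds) ns =
    ((case restrict d W ns of None \<Rightarrow> True | Some (W', ns') \<Rightarrow> f W' ns') \<and>
     search_all f W ds (d # ns))"

text \<open>The number is only fuel: running out yields \<open>False\<close>, so it can never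
  produce a wrong positive answer.\<close>

primrec search :: "nat \<Rightarrow> vec list \<Rightarrow> vec list \<Rightarrow> bool" where
  "search 0 = (\<lambda>W ns. False)"
| "search (Suc k) =
    (\<lambda>W ns. case branch W ns of None \<Rightarrow> terminal W | Some ds \<Rightarrow> search_all (search k) W ds ns)"

subsection \<open>Evaluation of the search by rewriting\<close>

text \<open>
  The auxiliary constants make the evaluation lazy: rewriting normalizes the arguments of a
  function but, unlike for \<open>if\<close> and \<open>case\<close>, does not visit them again after the next step.
\<close>

definition "vcmp_aux c c' xs ys = (if join c c' = Mixed then Mixed else vcmp (join c c') xs ys)"
definition "vnorm_aux b v = (if b then v else vneg v)"
definition "scan_aux c v w ws ds =
    (case c of Equal \<Rightarrow> None | Greater \<Rightarrow> Some ds | Less \<Rightarrow> scan v ws ds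
      | Mixed \<Rightarrow> scan v ws (vnorm (vsub v w) # ds))"
definition "scan_old_aux c n b ys = (case c of None \<Rightarrow> None | Some ds' \<Rightarrow> scan_old n b ys ds')"
definition "end_select_aux c W bs n k ds = (case c of None \<Rightarrow> end_select W bs (Suc n) (Suc k) ds
      | Some ds' \<Rightarrow> end_select W bs (Suc n) k ds')"
fun veq :: "vec \<Rightarrow> vec \<Rightarrow> bool" where
  "veq (x # xs) (y # ys) = (x = y \<and> veq xs ys)" | "veq [] [] = True" | "veq _ _ = False"
definition "veq_aux b xs ys = (b \<and> veq xs ys)"
definition "vmem_aux b v ws = (b \<or> vmem v ws)"
definition "is_sum_aux b y bs = (b \<or> is_sum y bs)"
definition "incr_unless b n = (if b then n else Suc n)"
definition "scan_rows_aux c v rs = (case c of None \<Rightarrow> None | Some ds' \<Rightarrow> scan_rows v rs ds')"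
definition "row_select_aux c rows vs k ds = (case c of None \<Rightarrow> row_select rows vs (Suc k) ds
      | Some ds' \<Rightarrow> row_select rows vs k ds')"
definition "all_select_aux c rows W = (case c of (m', ds') \<Rightarrow> if m' = 0 then Some ds'
      else all_select (W # rows) (rebase W) m' ds')"
definition "dedup_aux2 b ns d ds out = (if b then dedup ns ds out else dedup ns ds (d # out))"
definition "dedup_aux1 b ns d ds out = (if b then dedup ns ds out else dedup_aux2 (vmem d out) ns d ds out)"
definition "better_aux b ds ds' = (if b then ds else ds')"
definition "branch_aux c W ns = (case c of None \<Rightarrow>
        (case reduced ns (end_cands (mirror W)) of
          None \<Rightarrow> reduced ns (all_cands W)
        | Some ds \<Rightarrow> Some ds)
    | Some ds \<Rightarrow>
        Some (if shorter ds [[]] then ds else better ds (reduced ns (end_cands (mirror W)))))"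
definition "branch_aux2 c W ns = (case c of None \<Rightarrow> reduced ns (all_cands W) | Some ds \<Rightarrow> Some ds)"
definition "mk_ray_aux b i x j y = (if b then Sum i j else Comb i x j y)"
definition "covers_aux b xs ys = (b \<and> covers xs ys)"
definition "any_covers_aux b p es = (b \<or> any_covers p es)"
definition "drop_covered_aux b p q e es = (if b then drop_covered p es else (q, e) # drop_covered p es)"
definition "extreme_aux b p e ks es = (if b then extreme ks es else extreme ((p, e) # drop_covered p ks) es)"
definition "clean_aux c v vs out = (case c of Equal \<Rightarrow> None
    | Mixed \<Rightarrow> clean vs (vnorm v # out) | Less \<Rightarrow> clean vs out | Greater \<Rightarrow> clean vs out)"
definition "rays_aux s = (case s of (zs, us, vs) \<Rightarrow> extreme [] (combine us vs zs))"
definition "restrict_aux1 es W ns = (if none_true (common_zeros (map (\<lambda>_. True) W) es)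
      then map_option (Pair (project_all es W)) (clean (project_all es ns) []) else None)"
definition "restrict_aux2 b es W ns = (if b
      then map_option (Pair (project_all es W)) (clean (project_all es ns) []) else None)"
definition "restrict_aux3 c es W = map_option (Pair (project_all es W)) c"
definition "search_all_aux b f W d ds ns = (b \<and> search_all f W ds (d # ns))"
definition "child f c = (case c of None \<Rightarrow> True | Some (W', ns') \<Rightarrow> f W' ns')"
definition "search_aux c f W ns = (case c of None \<Rightarrow> terminal W | Some ds \<Rightarrow> search_all f W ds ns)"
definition "terminal_aux c = (case c of
      [] \<Rightarrow> False
    | x # xs \<Rightarrow>
        veq (scale 14 (x # xs)) (scale x [14, 12, 11, 7, 4, 3, 2]) \<or>
        veq (scale 14 (x # xs)) (scale x [14, 12, 11, 10, 7, 3, 2]))"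

lemma veq_eq: "veq xs ys \<longleftrightarrow> xs = ys"
  by (induction xs ys rule: veq.induct) auto

lemma join_Equal [simp]: "join c Equal = c"
  by (cases c) auto

lemma vcmp_Mixed [simp]: "vcmp Mixed xs ys = Mixed"
  by (cases "(Mixed, xs, ys)" rule: vcmp.cases) auto

lemma vsgn_Mixed [simp]: "vsgn Mixed xs = Mixed"
  by (cases xs) auto

text \<open>The rules for \<open>vcmp\<close> mention only nonnegative entries because every vector
  compared is a larger element minus a smaller one, hence nonnegative on all rays.\<close>

lemma vector_eval:
  "vcmp c [] [] = c" "vcmp c (0 # xs) (0 # ys) = vcmp c xs ys"
  "vcmp Equal (0 # xs) (numeral n # ys) = vcmp Less xs ys"
  "vcmp Less (0 # xs) (numeral n # ys) = vcmp Less xs ys"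
  "vcmp Greater (0 # xs) (numeral n # ys) = Mixed"
  "vcmp Equal (numeral m # xs) (0 # ys) = vcmp Greater xs ys"
  "vcmp Less (numeral m # xs) (0 # ys) = Mixed"
  "vcmp Greater (numeral m # xs) (0 # ys) = vcmp Greater xs ys"
  "vcmp Equal (numeral m # xs) (numeral n # ys) = vcmp_aux Equal (num_cmp Equal m n) xs ys"
  "vcmp Less (numeral m # xs) (numeral n # ys) = vcmp_aux Less (num_cmp Equal m n) xs ys"
  "vcmp Greater (numeral m # xs) (numeral n # ys) = vcmp_aux Greater (num_cmp Equal m n) xs ys"
  "vcmp_aux c Equal xs ys = vcmp c xs ys"
  "vcmp_aux Equal Less xs ys = vcmp Less xs ys" "vcmp_aux Equal Greater xs ys = vcmp Greater xs ys"
  "vcmp_aux Less Less xs ys = vcmp Less xs ys" "vcmp_aux Less Greater xs ys = Mixed"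
  "vcmp_aux Greater Less xs ys = Mixed" "vcmp_aux Greater Greater xs ys = vcmp Greater xs ys"
  "vsub [] [] = []" "vsub (x # xs) (y # ys) = (x - y) # vsub xs ys"
  "leading_pos [] = True" "leading_pos (0 # xs) = leading_pos xs"
  "leading_pos (numeral n # xs) = True" "leading_pos (- numeral n # xs) = False"
  "vnorm v = vnorm_aux (leading_pos v) v" "vnorm_aux True v = v" "vnorm_aux False v = vneg v"
  "vsgn c [] = c" "vsgn c (0 # xs) = vsgn c xs"
  "vsgn Equal (numeral m # xs) = vsgn Greater xs" "vsgn Equal (- numeral m # xs) = vsgn Less xs"
  "vsgn Less (numeral m # xs) = Mixed" "vsgn Less (- numeral m # xs) = vsgn Less xs"
  "vsgn Greater (numeral m # xs) = vsgn Greater xs" "vsgn Greater (- numeral m # xs) = Mixed"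
  "veq [] [] = True" "veq (0 # xs) (0 # ys) = veq xs ys"
  "veq (numeral m # xs) (numeral n # ys) = veq_aux (m = n) xs ys"
  "veq (- numeral m # xs) (- numeral n # ys) = veq_aux (m = n) xs ys"
  "veq (0 # xs) (numeral n # ys) = False" "veq (0 # xs) (- numeral n # ys) = False"
  "veq (numeral n # xs) (0 # ys) = False" "veq (- numeral n # xs) (0 # ys) = False"
  "veq (numeral m # xs) (- numeral n # ys) = False" "veq (- numeral m # xs) (numeral n # ys) = False"
  "veq_aux True xs ys = veq xs ys" "veq_aux False xs ys = False"
  "vmem v (w # ws) = vmem_aux (veq v w) v ws" "vmem v [] = False"
  "vmem_aux True v ws = True" "vmem_aux False v ws = vmem v ws"
  by (simp_all add: int_cmp_def num_cmp_eq vcmp_aux_def vnorm_def vnorm_aux_def veq_aux_def vmem_aux_def veq_eq Let_def)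

lemma end_select_0: "end_select W bs n 0 ds = Some ds"
  by (cases bs) auto

lemma row_select_0: "row_select rows vs 0 ds = (0, ds)"
  by (cases vs) auto

lemma cands_eval:
  "scan v (w # ws) ds = scan_aux (vcmp Equal v w) v w ws ds"
  "scan_aux Equal v w ws ds = None" "scan_aux Greater v w ws ds = Some ds"
  "scan_aux Less v w ws ds = scan v ws ds"
  "scan_aux Mixed v w ws ds = scan v ws (vnorm (vsub v w) # ds)"
  "scan_old 0 b ys ds = Some ds"
  "scan_old (Suc n) b (y # ys) ds = scan_old_aux (scan (vsub y b) ys ds) n b ys"
  "scan_old_aux None n b ys = None" "scan_old_aux (Some ds) n b ys = scan_old n b ys ds"
  "end_select W bs n 0 ds = Some ds" "end_select W [] n (Suc k) ds = None"
  "end_select W (b # bs) n (Suc k) ds = end_select_aux (scan_old n b W ds) W bs n k ds"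
  "end_select_aux None W bs n k ds = end_select W bs (Suc n) (Suc k) ds"
  "end_select_aux (Some ds') W bs n k ds = end_select W bs (Suc n) k ds'"
  "is_sum y (b # bs) = is_sum_aux (vmem (vsub y b) (b # bs)) y bs"
  "is_sum_aux True y bs = True" "is_sum_aux False y bs = is_sum y bs"
  "new_sums [] = Suc 0" "new_sums (y # ys) = incr_unless (is_sum y ys) (new_sums ys)"
  "incr_unless True n = n" "incr_unless False n = Suc n"
  "(0::nat) div 2 = 0" "Suc 0 div 2 = 0" "Suc (Suc n) div 2 = Suc (n div 2)"
  "sum_bound [] = Suc 0" "sum_bound (w # ws) = new_sums (w # ws) + sum_bound (rebase (w # ws))"
  "0 + n = n" "Suc m + n = Suc (m + n)"
  "last [w] = w" "last (v # w # ws) = last (w # ws)"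
  "butlast [w] = []" "butlast (v # w # ws) = v # butlast (w # ws)"
  "scan_rows v (r # rs) ds = scan_rows_aux (scan v r ds) v rs"
  "scan_rows_aux None v rs = None" "scan_rows_aux (Some ds) v rs = scan_rows v rs ds"
  "row_select rows vs 0 ds = (0, ds)"
  "row_select rows [] (Suc k) ds = (Suc k, ds)"
  "row_select rows (v # vs) (Suc k) ds = row_select_aux (scan_rows v rows ds) rows vs k ds"
  "row_select_aux None rows vs k ds = row_select rows vs (Suc k) ds"
  "row_select_aux (Some ds') rows vs k ds = row_select rows vs k ds'"
  "all_select rows [] m ds = None"
  "all_select rows (w # ws) m ds = all_select_aux (row_select rows (w # ws) m ds) rows (w # ws)"
  "all_select_aux (0, ds) rows W = Some ds"
  "all_select_aux (Suc k, ds) rows W = all_select (W # rows) (rebase W) (Suc k) ds"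
  "dedup ns (d # ds) out = dedup_aux1 (vmem d ns) ns d ds out"
  "dedup_aux1 True ns d ds out = dedup ns ds out"
  "dedup_aux1 False ns d ds out = dedup_aux2 (vmem d out) ns d ds out"
  "dedup_aux2 True ns d ds out = dedup ns ds out"
  "dedup_aux2 False ns d ds out = dedup ns ds (d # out)"
  "reduced ns None = None" "reduced ns (Some ds) = Some (dedup ns ds [])"
  "better ds None = ds" "better ds (Some ds') = better_aux (shorter ds ds') ds ds'"
  "better_aux True ds ds' = ds" "better_aux False ds ds' = ds'"
  "branch W ns = branch_aux (reduced ns (end_cands W)) W ns"
  "branch_aux None W ns = branch_aux2 (reduced ns (end_cands (mirror W))) W ns"
  "branch_aux (Some []) W ns = Some []" "branch_aux (Some [d]) W ns = Some [d]"
  "branch_aux (Some (d # d' # ds)) W ns = Some (better (d # d' # ds) (reduced ns (end_cands (mirror W))))"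
  "branch_aux2 None W ns = reduced ns (all_cands W)" "branch_aux2 (Some ds) W ns = Some ds"
  using end_select_0[of W bs n ds] row_select_0[of rows vs ds]
  by (simp_all add: scan_aux_def scan_old_aux_def end_select_aux_def is_sum_aux_def incr_unless_def
      scan_rows_aux_def row_select_aux_def all_select_aux_def dedup_aux1_def dedup_aux2_def
      reduced_def better_def better_aux_def branch_def branch_aux_def branch_aux2_def
      sum_bound.simps[of "[]"] sum_bound.simps[of "w # ws"] all_select.simps[of rows "[]"] all_select.simps[of rows "w # ws"])

lemma restrict_eval:
  "eq_cols [] [] [] = []" "eq_cols (x # xs) (y # ys) (p # ps) = ((x = y) # p) # eq_cols xs ys ps"
  "split_rays i [] [] zs us vs = (zs, us, vs)"
  "split_rays i (0 # xs) (p # ps) zs us vs = split_rays (Suc i) xs ps ((p, Old i) # zs) us vs"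
  "split_rays i (numeral m # xs) (p # ps) zs us vs = split_rays (Suc i) xs ps zs ((p, i, numeral m) # us) vs"
  "split_rays i (- numeral m # xs) (p # ps) zs us vs = split_rays (Suc i) xs ps zs us ((p, i, numeral m) # vs)"
  "band [] [] = []" "band (True # bs) (b # cs) = b # band bs cs" "band (False # bs) (b # cs) = False # band bs cs"
  "mk_ray i x j y = mk_ray_aux (x = y) i x j y"
  "mk_ray_aux True i x j y = Sum i j" "mk_ray_aux False i x j y = Comb i x j y"
  "covers [] [] = True" "covers (True # bs) (b # cs) = covers bs cs"
  "covers (False # bs) (True # cs) = False" "covers (False # bs) (False # cs) = covers bs cs"
  "any_covers p ((q, e) # es) = any_covers_aux (covers q p) p es"
  "any_covers_aux True p es = True" "any_covers_aux False p es = any_covers p es"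
  "drop_covered p ((q, e) # es) = drop_covered_aux (covers p q) p q e es"
  "drop_covered_aux True p q e es = drop_covered p es"
  "drop_covered_aux False p q e es = (q, e) # drop_covered p es"
  "extreme ks ((p, e) # es) = extreme_aux (any_covers p ks) p e ks es"
  "extreme_aux True p e ks es = extreme ks es"
  "extreme_aux False p e ks es = extreme ((p, e) # drop_covered p ks) es"
  "none_true (True # bs) = False" "none_true (False # bs) = none_true bs"
  "clean (w # ws) out = clean_aux (vsgn Equal w) w ws out"
  "clean_aux Equal w ws out = None" "clean_aux Mixed w ws out = clean ws (vnorm w # out)"
  "clean_aux Less w ws out = clean ws out" "clean_aux Greater w ws out = clean ws out"
  "rays d W = rays_aux (split_rays 0 d (patterns (W @ [map (\<lambda>_. 0) d])) [] [] [])"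
  "rays_aux (zs, us, vs) = extreme [] (combine us vs zs)"
  "restrict d W ns = restrict_aux1 (rays d W) W ns"
  "restrict_aux1 es W ns = restrict_aux2 (none_true (common_zeros (map (\<lambda>_. True) W) es)) es W ns"
  "restrict_aux2 False es W ns = None"
  "restrict_aux2 True es W ns = restrict_aux3 (clean (project_all es ns) []) es W"
  "restrict_aux3 None es W = None" "restrict_aux3 (Some ns) es W = Some (project_all es W, ns)"
  "terminal W = terminal_aux (scalars W)" "terminal_aux [] = False"
  "terminal_aux (x # xs) \<longleftrightarrow>
     (veq (scale 14 (x # xs)) (scale x [14, 12, 11, 7, 4, 3, 2]) \<or>
      veq (scale 14 (x # xs)) (scale x [14, 12, 11, 10, 7, 3, 2]))"
  "search_all f W (d # ds) ns = search_all_aux (child f (restrict d W ns)) f W d ds ns"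
  "search_all_aux True f W d ds ns = search_all f W ds (d # ns)"
  "search_all_aux False f W d ds ns = False"
  "child f None = True" "child f (Some (W, ns)) = f W ns"
  "search (Suc k) W ns = search_aux (branch W ns) (search k) W ns"
  "search_aux None f W ns = terminal W" "search_aux (Some ds) f W ns = search_all f W ds ns"
  by (simp_all add: mk_ray_aux_def mk_ray_def covers_aux_def any_covers_aux_def drop_covered_aux_def
      extreme_aux_def clean_aux_def rays_def rays_aux_def restrict_def restrict_aux1_def restrict_aux2_def
      restrict_aux3_def terminal_def terminal_aux_def veq_eq search_all_aux_def child_def search_aux_def Let_def
      split: list.split)

text \<open>Keeps every nonzero integer, including 1, in the shape \<open>numeral n\<close> or
  \<open>- numeral n\<close> on which the rules above match.\<close>

lemma int_eval:
  "(0::int) = 0 \<longleftrightarrow> True" "numeral m = (0::int) \<longleftrightarrow> False" "0 = (numeral m::int) \<longleftrightarrow> False"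
  "numeral m = (numeral n::int) \<longleftrightarrow> m = n"
  "(1::int) = Numeral1" "- (0::int) = 0" "- (- x) = (x::int)"
  "(0::int) + x = x" "x + (0::int) = x" "numeral m + (numeral n::int) = numeral (m + n)"
  "numeral m + (- numeral n::int) = Num.sub m n" "- numeral m + (numeral n::int) = Num.sub n m"
  "- numeral m + (- numeral n::int) = - numeral (m + n)"
  "x - (0::int) = x" "(0::int) - numeral n = - numeral n" "numeral m - (numeral n::int) = Num.sub m n"
  "(0::int) * x = 0" "x * (0::int) = 0" "numeral m * (numeral n::int) = numeral (m * n)"
  "numeral m * (- numeral n::int) = - numeral (m * n)"
  "Num.sub num.One num.One = (0::int)" "Num.sub num.One (num.Bit0 n) = - (numeral (Num.BitM n)::int)"
  "Num.sub num.One (num.Bit1 n) = - (numeral (num.Bit0 n)::int)"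
  "Num.sub (num.Bit0 m) num.One = (numeral (Num.BitM m)::int)"
  "Num.sub (num.Bit1 m) num.One = (numeral (num.Bit0 m)::int)"
  "Num.sub (num.Bit0 m) (num.Bit0 n) = Num.dbl (Num.sub m n :: int)"
  "Num.sub (num.Bit1 m) (num.Bit1 n) = Num.dbl (Num.sub m n :: int)"
  "Num.sub (num.Bit1 m) (num.Bit0 n) = Num.dbl_inc (Num.sub m n :: int)"
  "Num.sub (num.Bit0 m) (num.Bit1 n) = Num.dbl_dec (Num.sub m n :: int)"
  "Num.dbl (0::int) = 0" "Num.dbl (numeral n::int) = numeral (num.Bit0 n)"
  "Num.dbl (- numeral n::int) = - numeral (num.Bit0 n)"
  "Num.dbl_inc (0::int) = Numeral1" "Num.dbl_inc (numeral n::int) = numeral (num.Bit1 n)"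
  "Num.dbl_inc (- numeral n::int) = - numeral (Num.BitM n)"
  "Num.dbl_dec (0::int) = - Numeral1" "Num.dbl_dec (numeral n::int) = numeral (Num.BitM n)"
  "Num.dbl_dec (- numeral n::int) = - numeral (num.Bit1 n)"
  by simp_all

lemmas search_eval =
  num_cmp.simps vector_eval vneg.simps scan.simps(1) cands_eval end_cands_def is_sum.simps(1)
  mirror.simps translate.simps rebase_def list.map rev.simps append.simps scan_rows.simps(1) all_cands_def
  dedup.simps(1) shorter.simps patterns.simps combine1.simps combine.simps any_covers.simps(1)
  drop_covered.simps(1) extreme.simps(1) common_zeros.simps none_true.simps(1) nth_Cons_0 nth_Cons_Suc
  ray_entry.simps project.simps project_all.simps clean.simps(1) scale.simps scalars.simps
  restrict_eval search_all.simps(1) simp_thms(29-34) int_eval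
  add_num_simps mult_num_simps eq_num_simps Num.BitM.simps

subsection \<open>Soundness of branching\<close>

text \<open>The value of the form at the point obtained by adding up the rays with weights
  \<mu>.\<close>

definition dot :: "(nat \<Rightarrow> real) \<Rightarrow> vec \<Rightarrow> real" where
  "dot \<mu> v = (\<Sum>i<length v. \<mu> i * real_of_int (v ! i))"

lemma length_vsub [simp]: "length (vsub v w) = min (length v) (length w)"
  by (induction v w rule: vsub.induct) auto

lemma nth_vsub: "i < length v \<Longrightarrow> i < length w \<Longrightarrow> vsub v w ! i = v ! i - w ! i"
  by (induction v w arbitrary: i rule: vsub.induct) (auto simp: nth_Cons split: nat.split)

lemma dot_vsub: "length v = length w \<Longrightarrow> dot \<mu> (vsub v w) = dot \<mu> v - dot \<mu> w"
  by (simp add: dot_def nth_vsub sum_subtractf algebra_simps)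

lemma vneg_map: "vneg v = map uminus v"
  by (induction v) auto

lemma dot_vneg: "dot \<mu> (vneg v) = - dot \<mu> v"
  by (simp add: dot_def vneg_map sum_negf)

lemma length_vnorm [simp]: "length (vnorm v) = length v"
  by (simp add: vnorm_def vneg_map)

lemma dot_vnorm_eq_0: "dot \<mu> (vnorm v) = 0 \<longleftrightarrow> dot \<mu> v = 0"
  by (simp add: vnorm_def dot_vneg)

lemma vmem_iff [simp]: "vmem v ws \<longleftrightarrow> v \<in> set ws"
  by (induction ws) auto

text \<open>For the induction the accumulator is arbitrary: a strict \<open>c\<close> records an
  earlier strict coordinate and replaces the conclusion v \<noteq> w.\<close>

lemma vcmp_sound:
  assumes "length v = length w"
  shows "(vcmp c v w = Equal \<longrightarrow> c = Equal \<and> v = w) \<and>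
    (vcmp c v w = Greater \<longrightarrow>
      (c = Equal \<or> c = Greater) \<and> list_all2 (\<le>) w v \<and> (c = Greater \<or> v \<noteq> w)) \<and>
    (vcmp c v w = Less \<longrightarrow>
      (c = Equal \<or> c = Less) \<and> list_all2 (\<le>) v w \<and> (c = Less \<or> v \<noteq> w))"
  using assms
proof (induction v w arbitrary: c rule: list_induct2)
  case Nil
  then show ?case by simp
next
  case (Cons x xs y ys)
  show ?case
    using Cons.IH[of Equal] Cons.IH[of Less] Cons.IH[of Greater]
    by (cases c) (auto simp: Let_def int_cmp_def split: if_splits)
qed

lemma vsgn_sound:
  "(vsgn c v = Equal \<longrightarrow> c = Equal \<and> (\<forall>x\<in>set v. x = 0))"
proof (induction v arbitrary: c)
  case Nil
  then show ?case by simp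
next
  case (Cons x xs)
  show ?case
    using Cons.IH[of Equal] Cons.IH[of Less] Cons.IH[of Greater]
    by (cases c) (auto simp: Let_def int_cmp_def split: if_splits)
qed

lemma dot_0: "(\<And>x. x \<in> set v \<Longrightarrow> x = 0) \<Longrightarrow> dot \<mu> v = 0"
  unfolding dot_def by (intro sum.neutral) (auto simp: in_set_conv_nth)

lemma dot_less:
  assumes "list_all2 (\<le>) v w" "v \<noteq> w" "\<And>i. i < length v \<Longrightarrow> 0 < \<mu> i"
  shows "dot \<mu> v < dot \<mu> w"
proof -
  have len: "length v = length w" and le: "\<And>i. i < length v \<Longrightarrow> v ! i \<le> w ! i"
    using assms(1) by (auto simp: list_all2_conv_all_nth)
  obtain i where i: "i < length v" "v ! i \<noteq> w ! i"
    using assms(2) len by (auto simp: list_eq_iff_nth_eq)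
  have "(\<Sum>i<length v. \<mu> i * real_of_int (v ! i)) < (\<Sum>i<length v. \<mu> i * real_of_int (w ! i))"
  proof (rule sum_strict_mono_ex1)
    show "\<forall>i\<in>{..<length v}. \<mu> i * real_of_int (v ! i) \<le> \<mu> i * real_of_int (w ! i)"
      using assms(3) le by (auto intro!: mult_left_mono less_imp_le)
    show "\<exists>i\<in>{..<length v}. \<mu> i * real_of_int (v ! i) < \<mu> i * real_of_int (w ! i)"
      using i le[of i] assms(3)[of i] by (intro bexI[of _ i]) auto
  qed simp
  then show ?thesis
    by (simp add: dot_def len)
qed

text \<open>Used in both directions: it must hold for a list of candidates, and must fail for the
  list of excluded equations.\<close>

definition vanishes :: "(nat \<Rightarrow> real) \<Rightarrow> vec list \<Rightarrow> bool" where
  "vanishes \<mu> ds \<longleftrightarrow> (\<exists>d\<in>set ds. dot \<mu> d = 0)"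

lemma set_dedup: "set (dedup ns ds out) = set out \<union> (set ds - set ns)"
  by (induction ds arbitrary: out) auto

lemma vanishes_dedup:
  "vanishes \<mu> ds \<Longrightarrow> \<not> vanishes \<mu> ns \<Longrightarrow> vanishes \<mu> (dedup ns ds out)"
  by (auto simp: vanishes_def set_dedup)

lemma shorter_cases: "better ds c = ds \<or> c = Some (better ds c)"
  by (simp add: better_def split: option.split)

text \<open>\<open>V\<close> will be the set of forms determined by the gaps. Passing to a section
  requires its equation to be of this kind, so membership in \<open>V\<close> is tracked along with
  soundness.\<close>

locale positive_weights =
  fixes \<mu> :: "nat \<Rightarrow> real" and R :: nat and V :: "vec set"
  assumes pos: "\<And>i. i < R \<Longrightarrow> 0 < \<mu> i"
    and len: "\<And>v. v \<in> V \<Longrightarrow> length v = R"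
    and vsub_V: "\<And>v w. v \<in> V \<Longrightarrow> w \<in> V \<Longrightarrow> vsub v w \<in> V"
    and vneg_V: "\<And>v. v \<in> V \<Longrightarrow> vneg v \<in> V"
begin

abbreviation val :: "vec \<Rightarrow> real" where "val \<equiv> dot \<mu>"

abbreviation descending :: "vec list \<Rightarrow> bool" where
  "descending \<equiv> sorted_wrt (\<lambda>v w. val w < val v)"

lemma val_vsub [simp]: "v \<in> V \<Longrightarrow> w \<in> V \<Longrightarrow> val (vsub v w) = val v - val w"
  by (simp add: dot_vsub len)

lemma vnorm_V: "v \<in> V \<Longrightarrow> vnorm v \<in> V"
  by (simp add: vnorm_def vneg_V)

section \<open>Completeness of the candidate lists\<close>

lemma scan_sound:
  assumes "v \<in> V" "set ws \<subseteq> V" "set ds \<subseteq> V" "descending ws"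
  shows "(scan v ws ds = None \<longrightarrow> v \<in> set ws) \<and>
    (\<forall>ds'. scan v ws ds = Some ds' \<longrightarrow> set ds \<subseteq> set ds' \<and> set ds' \<subseteq> V \<and>
      (val v \<in> val ` set ws \<longrightarrow> vanishes \<mu> ds'))"
  using assms
proof (induction ws arbitrary: ds)
  case Nil
  then show ?case by simp
next
  case (Cons w ws)
  have l: "length v = length w"
    using Cons.prems by (simp add: len)
  note cmp = vcmp_sound[OF l, of Equal]
  have less: "val v < val w" if "vcmp Equal v w = Less"
    using cmp that pos Cons.prems by (intro dot_less) (auto simp: len)
  have greater: "val w < val v" if "vcmp Equal v w = Greater"
    using cmp that pos Cons.prems by (intro dot_less) (auto simp: len)
  show ?case
  proof (cases "vcmp Equal v w")
    case Equal
    then show ?thesis using cmp by simp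
  next
    case Less
    then have "val v \<noteq> val w" using less by simp
    moreover have "(scan v ws ds = None \<longrightarrow> v \<in> set ws) \<and>
      (\<forall>ds'. scan v ws ds = Some ds' \<longrightarrow> set ds \<subseteq> set ds' \<and> set ds' \<subseteq> V \<and>
        (val v \<in> val ` set ws \<longrightarrow> vanishes \<mu> ds'))"
      using Cons.prems by (intro Cons.IH) auto
    ultimately show ?thesis using Less by simp
  next
    case Greater
    then have "val v \<notin> val ` set (w # ws)"
      using greater Cons.prems(4) by (auto dest: less_trans)
    then show ?thesis using Greater Cons.prems(3) by simp
  next
    case Mixed
    let ?d = "vnorm (vsub v w)"
    have d: "?d \<in> V" "val v = val w \<Longrightarrow> val ?d = 0"
      using Cons.prems by (auto simp: vnorm_V vsub_V dot_vnorm_eq_0)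
    have "(scan v ws (?d # ds) = None \<longrightarrow> v \<in> set ws) \<and>
      (\<forall>ds'. scan v ws (?d # ds) = Some ds' \<longrightarrow> set (?d # ds) \<subseteq> set ds' \<and> set ds' \<subseteq> V \<and>
        (val v \<in> val ` set ws \<longrightarrow> vanishes \<mu> ds'))"
      using Cons.prems d(1) by (intro Cons.IH) auto
    then show ?thesis
      using Mixed d(2) by (auto simp: vanishes_def)
  qed
qed

lemma vanishes_mono: "vanishes \<mu> ds \<Longrightarrow> set ds \<subseteq> set ds' \<Longrightarrow> vanishes \<mu> ds'"
  by (auto simp: vanishes_def)

lemma scan_old_sound:
  assumes "scan_old n b Q ds = Some ds'" "b \<in> V" "set Q \<subseteq> V" "set ds \<subseteq> V" "descending Q"
  shows "set ds \<subseteq> set ds' \<and> set ds' \<subseteq> V \<and>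
    (\<forall>i<n. i < length Q \<longrightarrow> val (Q ! i) - val b \<in> val ` set (drop (Suc i) Q) \<longrightarrow> vanishes \<mu> ds')"
  using assms
proof (induction n b Q ds rule: scan_old.induct)
  case (1 n b y ys ds)
  obtain ds1 where ds1: "scan (vsub y b) ys ds = Some ds1"
    using "1.prems"(1) by (auto split: option.splits)
  have s: "set ds \<subseteq> set ds1 \<and> set ds1 \<subseteq> V \<and> (val (vsub y b) \<in> val ` set ys \<longrightarrow> vanishes \<mu> ds1)"
    using scan_sound[of "vsub y b" ys ds] "1.prems" ds1 by (auto simp: vsub_V)
  have IH: "set ds1 \<subseteq> set ds' \<and> set ds' \<subseteq> V \<and>
    (\<forall>i<n. i < length ys \<longrightarrow> val (ys ! i) - val b \<in> val ` set (drop (Suc i) ys) \<longrightarrow> vanishes \<mu> ds')"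
    using "1.prems" ds1 s by (intro "1.IH") auto
  have "vanishes \<mu> ds'"
    if i: "i < Suc n" "i < length (y # ys)" "val ((y # ys) ! i) - val b \<in> val ` set (drop (Suc i) (y # ys))" for i
  proof (cases i)
    case 0
    then have "vanishes \<mu> ds1" using i s "1.prems" by simp
    then show ?thesis using IH vanishes_mono by blast
  next
    case (Suc j)
    then show ?thesis using i IH by simp
  qed
  then show ?case using s IH by blast
qed auto

lemma descending_nth:
  assumes "descending W" "i < length W" "j < length W" "val (W ! j) < val (W ! i)"
  shows "i < j"
  using assms sorted_wrt_nth_less[OF assms(1), of j i] by (cases i j rule: linorder_cases) auto

lemma scan_old_complete:
  assumes W: "set W \<subseteq> V" "descending W" "\<And>w. w \<in> set W \<Longrightarrow> 0 < val w"
    and s: "scan_old n (W ! n) W ds = Some ds'" "n < length W" "set ds \<subseteq> V"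
    and c: "y \<in> val ` set W" "c \<in> val ` set W" "y = val (W ! n) + c"
  shows "vanishes \<mu> ds'"
proof -
  obtain i where i: "i < length W" "y = val (W ! i)"
    using c(1) by (auto simp: in_set_conv_nth)
  obtain j where j: "j < length W" "c = val (W ! j)"
    using c(2) by (auto simp: in_set_conv_nth)
  have "0 < c" "0 < val (W ! n)"
    using c(2) W(3) s(2) by auto
  \<comment> \<open>A sum of positive numbers exceeds both summands, so y comes before both in the
    descending list. This is why \<open>scan_old\<close> tries only the first n elements as y and
    looks for c only beyond y.\<close>
  then have "i < n" "i < j"
    using descending_nth[OF W(2)] i j c(3) s(2) by auto
  then have "c \<in> val ` set (drop (Suc i) W)"
    using j by (auto simp: in_set_conv_nth intro!: image_eqI[of _ _ "W ! j"] exI[of _ "j - Suc i"])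
  moreover have "val (W ! i) - val (W ! n) = c"
    using i c(3) by simp
  moreover have "W ! n \<in> V"
    using W(1) s(2) by auto
  then have "\<forall>i<n. i < length W \<longrightarrow> val (W ! i) - val (W ! n) \<in> val ` set (drop (Suc i) W) \<longrightarrow>
      vanishes \<mu> ds'"
    using scan_old_sound[OF s(1) _ W(1) s(3) W(2)] by blast
  ultimately show ?thesis
    using i(1) \<open>i < n\<close> by simp
qed

lemma end_select_sound:
  assumes W: "set W \<subseteq> V" "descending W" "\<And>w. w \<in> set W \<Longrightarrow> 0 < val w"
    and "end_select W (drop n W) n m ds = Some ds'" "set ds \<subseteq> V"
  shows "set ds \<subseteq> set ds' \<and> set ds' \<subseteq> V \<and>
    (\<exists>C \<subseteq> val ` set (drop n W). card C = m \<and>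
      (\<forall>b\<in>C. (\<exists>y\<in>val ` set W. \<exists>c\<in>val ` set W. y = b + c) \<longrightarrow> vanishes \<mu> ds'))"
  using assms(4,5)
proof (induction "length W - n" arbitrary: n m ds)
  case 0
  then show ?case by (auto split: nat.splits)
next
  case (Suc k)
  then have n: "n < length W" by simp
  have dn: "drop n W = W ! n # drop (Suc n) W"
    using n by (simp add: Cons_nth_drop_Suc)
  have sub: "val ` set (drop (Suc n) W) \<subseteq> val ` set (drop n W)"
    unfolding dn by auto
  show ?case
  proof (cases m)
    case 0
    then have "ds' = ds"
      using Suc.prems(1) by (simp add: dn)
    then show ?thesis
      using Suc.prems(2) 0 by (intro conjI exI[of _ "{}"]) simp_all
  next
    case m: (Suc m')
    show ?thesis
    proof (cases "scan_old n (W ! n) W ds")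
      case None
      then have e: "end_select W (drop (Suc n) W) (Suc n) m ds = Some ds'"
        using Suc.prems(1) m by (simp add: dn)
      have k: "k = length W - Suc n"
        using Suc.hyps(2) by simp
      note Suc.hyps(1)[OF k e Suc.prems(2)]
      then obtain C where C: "set ds \<subseteq> set ds'" "set ds' \<subseteq> V" "C \<subseteq> val ` set (drop (Suc n) W)" "card C = m"
        "\<forall>b\<in>C. (\<exists>y\<in>val ` set W. \<exists>c\<in>val ` set W. y = b + c) \<longrightarrow> vanishes \<mu> ds'"
        by blast
      have "C \<subseteq> val ` set (drop n W)"
        using C(3) sub by (rule order_trans)
      then show ?thesis
        using C by (intro conjI exI[of _ C]) simp_all
    next
      case (Some ds1)
      have "W ! n \<in> V"
        using W(1) n by auto
      from scan_old_sound[OF Some this W(1) Suc.prems(2) W(2)]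
      have s: "set ds \<subseteq> set ds1" "set ds1 \<subseteq> V"
        by simp_all
      have e: "end_select W (drop (Suc n) W) (Suc n) m' ds1 = Some ds'"
        using Suc.prems(1) m Some by (simp add: dn)
      have k: "k = length W - Suc n"
        using Suc.hyps(2) by simp
      note Suc.hyps(1)[OF k e s(2)]
      then obtain C where C: "set ds1 \<subseteq> set ds'" "set ds' \<subseteq> V" "C \<subseteq> val ` set (drop (Suc n) W)" "card C = m'"
        "\<forall>b\<in>C. (\<exists>y\<in>val ` set W. \<exists>c\<in>val ` set W. y = b + c) \<longrightarrow> vanishes \<mu> ds'"
        by blast
      have "descending (W ! n # drop (Suc n) W)"
        unfolding dn[symmetric] by (rule sorted_wrt_drop[OF W(2)])
      then have lt: "val x < val (W ! n)" if "x \<in> set (drop (Suc n) W)" for x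
        using that by simp
      have "val (W ! n) \<notin> C"
      proof
        assume "val (W ! n) \<in> C"
        then obtain x where "x \<in> set (drop (Suc n) W)" "val (W ! n) = val x"
          using C(3) by blast
        then show False
          using lt[of x] by simp
      qed
      moreover have "finite C"
        using C(3) finite_subset by blast
      ultimately have "card (insert (val (W ! n)) C) = m"
        using C(4) m by simp
      moreover have "insert (val (W ! n)) C \<subseteq> val ` set (drop n W)"
        unfolding dn using C(3) by auto
      moreover have "vanishes \<mu> ds'"
        if "\<exists>y\<in>val ` set W. \<exists>c\<in>val ` set W. y = val (W ! n) + c"
      proof -
        from that obtain y c where "y \<in> val ` set W" "c \<in> val ` set W" "y = val (W ! n) + c"
          by blast
        from scan_old_complete[OF W Some n Suc.prems(2) this] show ?thesis
          using C(1) by (rule vanishes_mono)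
      qed
      then have "\<forall>b\<in>insert (val (W ! n)) C.
          (\<exists>y\<in>val ` set W. \<exists>c\<in>val ` set W. y = b + c) \<longrightarrow> vanishes \<mu> ds'"
        using C(5) by blast
      moreover have "set ds \<subseteq> set ds'"
        using s(1) C(1) by (rule order_trans)
      ultimately show ?thesis
        using C(2) by (intro conjI exI[of _ "insert (val (W ! n)) C"]) assumption+
    qed
  qed
qed

lemma is_sum_sound:
  assumes "is_sum y ys" "y \<in> V" "set ys \<subseteq> V"
  shows "\<exists>b\<in>val ` set ys. \<exists>c\<in>val ` set ys. val y = b + c"
  using assms
proof (induction ys)
  case Nil
  then show ?case by simp
next
  case (Cons b bs)
  show ?case
  proof (cases "vsub y b \<in> set (b # bs)")
    case True
    moreover have "val y = val b + val (vsub y b)"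
      using Cons.prems by simp
    ultimately show ?thesis by (metis image_eqI list.set_intros(1))
  next
    case False
    then show ?thesis using Cons by auto
  qed
qed

lemma new_sums_sound:
  assumes "set W \<subseteq> V" "descending W"
  shows "\<exists>Y \<subseteq> val ` set W. (\<forall>y\<in>Y. \<exists>b\<in>val ` set W. \<exists>c\<in>val ` set W. y = b + c) \<and>
    new_sums W + card Y = Suc (length W)"
  using assms
proof (induction W)
  case Nil
  then show ?case by simp
next
  case (Cons w ws)
  then obtain Y where Y: "Y \<subseteq> val ` set ws"
    "\<forall>y\<in>Y. \<exists>b\<in>val ` set ws. \<exists>c\<in>val ` set ws. y = b + c" "new_sums ws + card Y = Suc (length ws)"
    by auto
  show ?case
  proof (cases "is_sum w ws")
    case True
    have "val w \<notin> Y"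
      using Y(1) Cons.prems(2) by fastforce
    moreover have "finite Y"
      using Y(1) finite_subset by blast
    ultimately have "card (insert (val w) Y) = Suc (card Y)"
      by simp
    moreover have "\<exists>b\<in>val ` set ws. \<exists>c\<in>val ` set ws. val w = b + c"
      using is_sum_sound True Cons.prems by simp
    ultimately show ?thesis
      using True Y by (intro exI[of _ "insert (val w) Y"]) (auto, blast+)
  next
    case False
    then show ?thesis
      using Y by (intro exI[of _ Y]) (auto, blast+)
  qed
qed

lemma card_val: "descending W \<Longrightarrow> card (val ` set W) = length W"
proof (induction W)
  case (Cons w ws)
  then have "val w \<notin> val ` set ws" by auto
  then show ?case using Cons by simp
qed simp

lemma end_cands_sound:
  assumes W: "set W \<subseteq> V" "descending W" "\<And>w. w \<in> set W \<Longrightarrow> 0 < val w"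
    and "mstd (insert 0 (val ` set W))" "\<not> mstd (val ` set W)" "end_cands W = Some ds"
  shows "set ds \<subseteq> V \<and> vanishes \<mu> ds"
proof -
  let ?B = "val ` set W"
  obtain Y where Y: "Y \<subseteq> ?B" "\<forall>y\<in>Y. \<exists>b\<in>?B. \<exists>c\<in>?B. y = b + c" "new_sums W + card Y = Suc (length W)"
    using new_sums_sound[OF W(1,2)] by blast
  have "end_select W (drop 0 W) 0 (Suc (new_sums W) div 2) [] = Some ds"
    using assms(6) by (simp add: end_cands_def)
  from end_select_sound[OF W this] obtain C where C: "set ds \<subseteq> V" "C \<subseteq> ?B"
    "card C = Suc (new_sums W) div 2" "\<forall>b\<in>C. (\<exists>y\<in>?B. \<exists>c\<in>?B. y = b + c) \<longrightarrow> vanishes \<mu> ds"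
    by auto
  have "\<exists>b\<in>C. \<exists>y\<in>?B. \<exists>c\<in>?B. y = b + c"
  proof (rule end_coincidence)
    \<comment> \<open>Here |B| + 1 - |Y| equals \<open>new_sums W\<close>, and half of it rounded
      up, doubled, is at least as large.\<close>
    show "card ?B + 1 \<le> card Y + 2 * card C"
      using Y(3) C(3) card_val[OF W(2)] by simp
  qed (use assms Y C in auto)
  then show ?thesis using C by blast
qed

lemma set_translate: "set (translate p qs) = (\<lambda>q. vsub q p) ` set qs"
  by (induction qs) auto

lemma descending_translate:
  "p \<in> V \<Longrightarrow> set qs \<subseteq> V \<Longrightarrow> descending qs \<Longrightarrow> descending (translate p qs)"
  by (induction qs) (auto simp: set_translate)

lemma rebase:
  assumes "set W \<subseteq> V" "descending W" "W \<noteq> []"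
  shows "set (rebase W) \<subseteq> V" "descending (rebase W)" "\<And>w. w \<in> set (rebase W) \<Longrightarrow> 0 < val w"
    "insert 0 (val ` set (rebase W)) = (+) (- val (last W)) ` val ` set W"
proof -
  obtain Q p where W: "W = Q @ [p]"
    using assms(3) by (metis append_butlast_last_id)
  then have Q: "set Q \<subseteq> V" "p \<in> V" "descending Q" "\<And>q. q \<in> set Q \<Longrightarrow> val p < val q"
    using assms by (auto simp: sorted_wrt_append)
  show "set (rebase W) \<subseteq> V" "descending (rebase W)" "\<And>w. w \<in> set (rebase W) \<Longrightarrow> 0 < val w"
    using Q by (auto simp: W rebase_def set_translate vsub_V subset_iff intro: descending_translate)
  have "val ` set (rebase W) = (\<lambda>q. val q - val p) ` set Q"
    using Q by (force simp: W rebase_def set_translate)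
  then show "insert 0 (val ` set (rebase W)) = (+) (- val (last W)) ` val ` set W"
    by (auto simp: W image_image)
qed

lemma sum_bound_sound:
  assumes "set W \<subseteq> V" "descending W" "\<And>w. w \<in> set W \<Longrightarrow> 0 < val w"
  shows "card (insert 0 (val ` set W) + insert 0 (val ` set W)) \<le> sum_bound W"
  using assms
proof (induction W rule: sum_bound.induct)
  case (1 W)
  show ?case
  proof (cases "W = []")
    case True
    then show ?thesis by (simp add: sum_bound.simps)
  next
    case False
    let ?B = "val ` set W"
    obtain Y where Y: "Y \<subseteq> ?B" "\<forall>y\<in>Y. \<exists>b\<in>?B. \<exists>c\<in>?B. y = b + c" "new_sums W + card Y = Suc (length W)"
      using new_sums_sound[OF "1.prems"(1,2)] by blast
    have "card (insert 0 ?B + insert 0 ?B) + card Y \<le> card (?B + ?B) + card ?B + 1"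
      using Y "1.prems"(3) by (intro card_sumset_insert_le) fastforce+
    moreover have "card (?B + ?B) = card (insert 0 (val ` set (rebase W)) + insert 0 (val ` set (rebase W)))"
      by (simp only: rebase(4)[OF "1.prems"(1,2) False] sumset_translate card_translate)
    moreover have "\<dots> \<le> sum_bound (rebase W)"
      using rebase[OF "1.prems"(1,2) False] by (intro "1.IH"[OF False]) auto
    ultimately have "card (insert 0 ?B + insert 0 ?B) \<le> new_sums W + sum_bound (rebase W)"
      using Y(3) card_val[OF "1.prems"(2)] by simp
    then show ?thesis
      using False by (simp add: sum_bound.simps[of W])
  qed
qed

lemma scan_rows_sound:
  assumes "scan_rows v rows ds = Some ds'" "v \<in> V" "set ds \<subseteq> V"
    and "\<forall>r\<in>set rows. set r \<subseteq> V \<and> descending r"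
  shows "set ds \<subseteq> set ds' \<and> set ds' \<subseteq> V \<and>
    (val v \<in> (\<Union>r\<in>set rows. val ` set r) \<longrightarrow> vanishes \<mu> ds')"
  using assms
proof (induction rows arbitrary: ds)
  case Nil
  then show ?case by simp
next
  case (Cons r rows)
  obtain ds1 where ds1: "scan v r ds = Some ds1"
    using Cons.prems(1) by (auto split: option.splits)
  have s: "set ds \<subseteq> set ds1" "set ds1 \<subseteq> V" "val v \<in> val ` set r \<longrightarrow> vanishes \<mu> ds1"
    using scan_sound[of v r ds] Cons.prems(2-4) ds1 by simp_all
  have "set ds1 \<subseteq> set ds' \<and> set ds' \<subseteq> V \<and>
    (val v \<in> (\<Union>r\<in>set rows. val ` set r) \<longrightarrow> vanishes \<mu> ds')"
    using Cons.prems ds1 s by (intro Cons.IH) simp_all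
  moreover have "val v \<in> (\<Union>r\<in>set (r # rows). val ` set r) \<longleftrightarrow>
      val v \<in> val ` set r \<or> val v \<in> (\<Union>r\<in>set rows. val ` set r)"
    by simp
  ultimately show ?case
    using s vanishes_mono by (meson order_trans)
qed

lemma row_select_sound:
  assumes "row_select rows W m ds = (m', ds')" "set W \<subseteq> V" "descending W" "set ds \<subseteq> V"
    and "\<forall>r\<in>set rows. set r \<subseteq> V \<and> descending r"
  shows "set ds \<subseteq> set ds' \<and> set ds' \<subseteq> V \<and> (vanishes \<mu> ds' \<or>
    (\<exists>C \<subseteq> val ` set W. card C + m' = m \<and> C \<inter> (\<Union>r\<in>set rows. val ` set r) = {}))"
  using assms
proof (induction W arbitrary: m ds)
  case Nil
  then show ?case by auto
next
  case (Cons v vs)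
  show ?case
  proof (cases m)
    case 0
    then show ?thesis using Cons.prems by auto
  next
    case m: (Suc k)
    show ?thesis
    proof (cases "scan_rows v rows ds")
      case None
      have IH: "set ds \<subseteq> set ds' \<and> set ds' \<subseteq> V \<and> (vanishes \<mu> ds' \<or>
        (\<exists>C \<subseteq> val ` set vs. card C + m' = m \<and> C \<inter> (\<Union>r\<in>set rows. val ` set r) = {}))"
        using Cons.prems None m by (intro Cons.IH) simp_all
      show ?thesis
      proof (cases "vanishes \<mu> ds'")
        case True
        then show ?thesis using IH by simp
      next
        case False
        then obtain C where "C \<subseteq> val ` set vs" "card C + m' = m" "C \<inter> (\<Union>r\<in>set rows. val ` set r) = {}"
          using IH by blast
        then show ?thesis
          using IH by (intro conjI disjI2 exI[of _ C]) auto
      qed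
    next
      case (Some ds1)
      have s: "set ds \<subseteq> set ds1" "set ds1 \<subseteq> V"
        "val v \<in> (\<Union>r\<in>set rows. val ` set r) \<longrightarrow> vanishes \<mu> ds1"
        using scan_rows_sound[OF Some] Cons.prems(2,4,5) by simp_all
      have IH: "set ds1 \<subseteq> set ds' \<and> set ds' \<subseteq> V \<and> (vanishes \<mu> ds' \<or>
        (\<exists>C \<subseteq> val ` set vs. card C + m' = k \<and> C \<inter> (\<Union>r\<in>set rows. val ` set r) = {}))"
        using Cons.prems Some m s by (intro Cons.IH) simp_all
      show ?thesis
      proof (cases "vanishes \<mu> ds'")
        case True
        then show ?thesis using IH s by auto
      next
        case False
        then obtain C where C: "C \<subseteq> val ` set vs" "card C + m' = k"
          "C \<inter> (\<Union>r\<in>set rows. val ` set r) = {}"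
          using IH by blast
        have "val v \<notin> (\<Union>r\<in>set rows. val ` set r)"
          using s(3) False IH vanishes_mono by blast
        moreover have "val v \<notin> C"
          using C(1) Cons.prems(3) by fastforce
        moreover have "finite C"
          using C(1) finite_subset by blast
        ultimately show ?thesis
          using C IH s m by (intro conjI disjI2 exI[of _ "insert (val v) C"]) auto
      qed
    qed
  qed
qed

text \<open>Avoidance of the earlier rows is carried along so that the choices made in different
  rows are disjoint and their cardinalities add up.\<close>

lemma all_select_sound:
  assumes "all_select rows W m ds = Some ds'" "set W \<subseteq> V" "descending W" "set ds \<subseteq> V"
    and "\<And>w. w \<in> set W \<Longrightarrow> 0 < val w"
    and "\<forall>r\<in>set rows. set r \<subseteq> V \<and> descending r"
  shows "set ds \<subseteq> set ds' \<and> set ds' \<subseteq> V \<and> (vanishes \<mu> ds' \<or>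
    (\<exists>C \<subseteq> differences (insert 0 (val ` set W)). (\<forall>c\<in>C. 0 < c) \<and> card C = m \<and>
      C \<inter> (\<Union>r\<in>set rows. val ` set r) = {}))"
  using assms
proof (induction rows W m ds rule: all_select.induct)
  case (1 rows W m ds)
  let ?A = "insert 0 (val ` set W)" and ?D = "\<Union>r\<in>set rows. val ` set r"
  have W: "W \<noteq> []"
    using "1.prems"(1) by (auto simp: all_select.simps[of rows W])
  obtain m' ds1 where row: "row_select rows W m ds = (m', ds1)"
    by fastforce
  have s: "set ds \<subseteq> set ds1" "set ds1 \<subseteq> V" "vanishes \<mu> ds1 \<or>
    (\<exists>C \<subseteq> val ` set W. card C + m' = m \<and> C \<inter> ?D = {})"
    using row_select_sound[OF row "1.prems"(2-4,6)] by simp_all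
  have row_differences: "val ` set W \<subseteq> differences ?A"
    by (force simp: differences_iff)
  show ?case
  proof (cases "m' = 0")
    case True
    then have "ds' = ds1"
      using "1.prems"(1) row W by (simp add: all_select.simps[of rows W])
    show ?thesis
    proof (cases "vanishes \<mu> ds1")
      case True
      then show ?thesis using s \<open>ds' = ds1\<close> by simp
    next
      case False
      then obtain C where C: "C \<subseteq> val ` set W" "card C = m" "C \<inter> ?D = {}"
        using s(3) \<open>m' = 0\<close> by auto
      have "\<forall>c\<in>C. 0 < c"
        using C(1) "1.prems"(5) by blast
      moreover have "C \<subseteq> differences ?A"
        using C(1) row_differences by (rule order_trans)
      ultimately show ?thesis
        using s C \<open>ds' = ds1\<close> by (intro conjI disjI2 exI[of _ C]) simp_all
    qed
  next
    case False
    have "all_select (W # rows) (rebase W) m' ds1 = Some ds'"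
      using "1.prems"(1) row W False by (simp add: all_select.simps[of rows W])
    note IH = "1.IH"[OF W row[symmetric] False this]
    have r: "set ds1 \<subseteq> set ds' \<and> set ds' \<subseteq> V \<and> (vanishes \<mu> ds' \<or>
      (\<exists>C \<subseteq> differences (insert 0 (val ` set (rebase W))). (\<forall>c\<in>C. 0 < c) \<and> card C = m' \<and>
        C \<inter> (\<Union>r\<in>set (W # rows). val ` set r) = {}))"
      using rebase[OF "1.prems"(2,3) W] "1.prems"(2,3,6) s(2) by (intro IH) simp_all
    have sub: "set ds \<subseteq> set ds'"
      by (rule order_trans[OF s(1) conjunct1[OF r]])
    have ds'_V: "set ds' \<subseteq> V"
      by (rule conjunct1[OF conjunct2[OF r]])
    show ?thesis
    proof (cases "vanishes \<mu> ds'")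
      case True
      then show ?thesis using sub ds'_V by simp
    next
      case van: False
      then obtain C1 where C1: "C1 \<subseteq> val ` set W" "card C1 + m' = m" "C1 \<inter> ?D = {}"
        using s(3) van vanishes_mono[OF _ conjunct1[OF r]] by blast
      obtain C2 where C2: "C2 \<subseteq> differences (insert 0 (val ` set (rebase W)))" "\<forall>c\<in>C2. 0 < c" "card C2 = m'"
        "C2 \<inter> (\<Union>r\<in>set (W # rows). val ` set r) = {}"
        using van r by blast
      have "differences (insert 0 (val ` set (rebase W))) \<subseteq> differences ?A"
        unfolding rebase(4)[OF "1.prems"(2,3) W] differences_translate
        unfolding differences_def by (intro image_mono) auto
      then have "C1 \<union> C2 \<subseteq> differences ?A"
        by (intro Un_least order_trans[OF C1(1) row_differences] order_trans[OF C2(1)])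
      moreover have "card (C1 \<union> C2) = m"
      proof (subst card_Un_disjoint)
        show "finite C1"
          using C1(1) finite_subset by blast
        show "finite C2"
          by (rule finite_subset[OF C2(1)]) (simp add: finite_differences)
        show "C1 \<inter> C2 = {}"
          using C1(1) C2(4) by auto
        show "card C1 + card C2 = m"
          using C1(2) C2(3) by simp
      qed
      moreover have "\<forall>c\<in>C1. 0 < c"
        using C1(1) "1.prems"(5) by blast
      then have "\<forall>c\<in>C1 \<union> C2. 0 < c"
        using C2(2) by blast
      moreover have "C2 \<inter> ?D = {}"
        using C2(4) by auto
      then have "(C1 \<union> C2) \<inter> ?D = {}"
        using C1(3) by blast
      ultimately show ?thesis
        using sub ds'_V by (intro conjI disjI2 exI[of _ "C1 \<union> C2"])
    qed
  qed
qed

lemma all_cands_sound: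
  assumes W: "set W \<subseteq> V" "descending W" "\<And>w. w \<in> set W \<Longrightarrow> 0 < val w"
    and "mstd (insert 0 (val ` set W))" "all_cands W = Some ds"
  shows "set ds \<subseteq> V \<and> vanishes \<mu> ds"
proof -
  let ?A = "insert 0 (val ` set W)"
  have r: "set ds \<subseteq> V \<and> (vanishes \<mu> ds \<or>
    (\<exists>C \<subseteq> differences ?A. (\<forall>c\<in>C. 0 < c) \<and> card C = sum_bound W div 2))"
    using all_select_sound[of "[]" W "sum_bound W div 2" "[]" ds] assms by (auto simp: all_cands_def)
  have "False" if "C \<subseteq> differences ?A" "\<forall>c\<in>C. 0 < c" "card C = sum_bound W div 2" for C
  proof (rule all_coincidence[OF assms(4) _ that(1)])
    have "sum_bound W \<le> 2 * (sum_bound W div 2) + 1"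
      by arith
    then show "card (?A + ?A) \<le> 2 * card C + 1"
      using sum_bound_sound[OF W] that(3) by linarith
  qed (use that(2) in auto)
  then show ?thesis using r by blast
qed

lemma descending_mirror:
  "t \<in> V \<Longrightarrow> set ws \<subseteq> V \<Longrightarrow> descending ws \<Longrightarrow> descending (map (vsub t) (rev ws))"
  by (induction ws) (auto simp: sorted_wrt_append)

lemma mirror:
  assumes "set W \<subseteq> V" "descending W" "\<And>w. w \<in> set W \<Longrightarrow> 0 < val w" "W \<noteq> []"
  shows "set (mirror W) \<subseteq> V" "descending (mirror W)" "\<And>w. w \<in> set (mirror W) \<Longrightarrow> 0 < val w"
    "insert 0 (val ` set (mirror W)) = (\<lambda>a. val (hd W) - a) ` insert 0 (val ` set W)"
    "length (mirror W) = length W"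
proof -
  obtain t ws where W: "W = t # ws"
    using assms(4) by (cases W) auto
  have d: "descending (map (vsub t) (rev ws))"
    using assms by (intro descending_mirror) (auto simp: W)
  show "set (mirror W) \<subseteq> V" "\<And>w. w \<in> set (mirror W) \<Longrightarrow> 0 < val w" "length (mirror W) = length W"
    using assms by (auto simp: W vsub_V subset_iff)
  show "descending (mirror W)"
    using d assms by (auto simp: W subset_iff)
  have "t \<in> V" "set ws \<subseteq> V"
    using assms by (auto simp: W)
  then have "val ` vsub t ` set ws = (-) (val t) ` val ` set ws"
    unfolding image_image by (intro image_cong) auto
  then show "insert 0 (val ` set (mirror W)) = (\<lambda>a. val (hd W) - a) ` insert 0 (val ` set W)"
    by (simp add: W insert_commute)
qed

lemma branch_sound:
  assumes W: "set W \<subseteq> V" "descending W" "\<And>w. w \<in> set W \<Longrightarrow> 0 < val w" "W \<noteq> []"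
    and A: "mstd (insert 0 (val ` set W))"
    and H: "\<And>B :: real set. card B = length W \<Longrightarrow> \<not> mstd B"
    and ns: "\<not> vanishes \<mu> ns" and br: "branch W ns = Some ds"
  shows "set ds \<subseteq> V \<and> vanishes \<mu> ds"
proof -
  have red: "set es \<subseteq> V \<and> vanishes \<mu> es"
    if "reduced ns c = Some es" "\<And>es'. c = Some es' \<Longrightarrow> set es' \<subseteq> V \<and> vanishes \<mu> es'" for c es
    using that ns by (auto simp: reduced_def set_dedup intro: vanishes_dedup)
  note m = mirror[OF W]
  have lower: "set es \<subseteq> V \<and> vanishes \<mu> es" if "reduced ns (end_cands W) = Some es" for es
    by (rule red[OF that], rule end_cands_sound[OF W(1-3) A]) (simp_all add: H card_val W)
  have "mstd (insert 0 (val ` set (mirror W)))"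
    using A by (simp only: m(4) mstd_reflect)
  moreover have "\<not> mstd (val ` set (mirror W))"
    using H card_val[OF m(2)] m(5) by simp
  ultimately have upper: "set es \<subseteq> V \<and> vanishes \<mu> es"
    if "reduced ns (end_cands (mirror W)) = Some es" for es
    by (intro red[OF that] end_cands_sound[OF m(1-3)])
  have all: "set es \<subseteq> V \<and> vanishes \<mu> es" if "reduced ns (all_cands W) = Some es" for es
    by (intro red[OF that] all_cands_sound[OF W(1-3) A])
  show ?thesis
  proof (cases "reduced ns (end_cands W)")
    case None
    then show ?thesis
      using br upper all by (auto simp: branch_def split: option.splits)
  next
    case (Some es)
    then have "ds = es \<or> ds = better es (reduced ns (end_cands (mirror W)))"
      using br by (auto simp: branch_def split: if_splits)
    then have "ds = es \<or> reduced ns (end_cands (mirror W)) = Some ds"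
      using shorter_cases[of es "reduced ns (end_cands (mirror W))"] by auto
    then show ?thesis
      using lower[OF Some] upper by blast
  qed
qed

end

subsection \<open>Soundness of passing to a hyperplane section\<close>

text \<open>
  By induction on the support: some ray of the section has its support inside that of \<open>\<mu>\<close>, and
  subtracting the largest possible multiple of it makes a further coordinate vanish.
\<close>

lemma conic_generation:
  fixes \<delta> :: "nat \<Rightarrow> nat \<Rightarrow> real" and D :: "nat \<Rightarrow> real" and \<rho> :: "nat \<Rightarrow> nat \<Rightarrow> real" and R m n :: nat
  defines "G \<equiv> \<lambda>\<mu> k. \<Sum>i<R. \<mu> i * \<delta> k i" and "H \<equiv> \<lambda>\<mu>. \<Sum>i<R. \<mu> i * D i"
  assumes nonneg: "\<And>k i. k < m \<Longrightarrow> i < R \<Longrightarrow> 0 \<le> \<delta> k i"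
    and gen: "\<And>\<mu>. \<forall>k<m. 0 \<le> G \<mu> k \<Longrightarrow> \<exists>\<nu>. (\<forall>i<R. 0 \<le> \<nu> i) \<and> (\<forall>k<m. G \<nu> k = G \<mu> k)"
    and compat: "\<And>\<mu>. \<forall>k<m. G \<mu> k = 0 \<Longrightarrow> H \<mu> = 0"
    and ray: "\<And>f. f < n \<Longrightarrow> H (\<rho> f) = 0" "\<And>f k. f < n \<Longrightarrow> k < m \<Longrightarrow> 0 \<le> G (\<rho> f) k"
      "\<And>f. f < n \<Longrightarrow> \<exists>k<m. G (\<rho> f) k \<noteq> 0"
    and old: "\<And>i. i < R \<Longrightarrow> D i = 0 \<Longrightarrow> \<exists>f<n. \<forall>k<m. \<delta> k i = 0 \<longrightarrow> G (\<rho> f) k = 0"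
    and new: "\<And>i j. i < R \<Longrightarrow> j < R \<Longrightarrow> 0 < D i \<Longrightarrow> D j < 0 \<Longrightarrow>
      \<exists>f<n. \<forall>k<m. \<delta> k i = 0 \<and> \<delta> k j = 0 \<longrightarrow> G (\<rho> f) k = 0"
    and \<mu>: "\<forall>k<m. 0 \<le> G \<mu> k" "H \<mu> = 0"
  shows "\<exists>c. (\<forall>f<n. 0 \<le> c f) \<and> (\<forall>k<m. G \<mu> k = (\<Sum>f<n. c f * G (\<rho> f) k))"
  using \<mu>
proof (induction "card {k. k < m \<and> G \<mu> k \<noteq> 0}" arbitrary: \<mu> rule: less_induct)
  case less
  have G_diff: "G (\<lambda>i. \<mu> i - a * \<nu> i) k = G \<mu> k - a * G \<nu> k" for \<mu> \<nu> a k
    by (simp add: G_def left_diff_distrib sum_subtractf sum_distrib_left mult.assoc)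
  have H_diff: "H (\<lambda>i. \<mu> i - a * \<nu> i) = H \<mu> - a * H \<nu>" for \<mu> \<nu> a
    by (simp add: H_def left_diff_distrib sum_subtractf sum_distrib_left mult.assoc)
  show ?case
  proof (cases "\<forall>k<m. G \<mu> k = 0")
    case True
    then show ?thesis by (intro exI[of _ "\<lambda>_. 0"]) simp
  next
    case False
    then obtain k0 where k0: "k0 < m" "G \<mu> k0 \<noteq> 0" by blast
    obtain \<nu> where \<nu>: "\<forall>i<R. 0 \<le> \<nu> i" "\<forall>k<m. G \<nu> k = G \<mu> k"
      using gen less.prems(1) by blast
    \<comment> \<open>By \<open>compat\<close> the value of H depends only on G, so the nonnegative
      representative satisfies the equation too. The factor 1 brings the difference into the form of
      \<open>G_diff\<close>.\<close>
    have "H (\<lambda>i. \<mu> i - 1 * \<nu> i) = 0"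
      using \<nu>(2) by (intro compat) (simp only: G_diff, simp)
    then have H\<nu>: "H \<nu> = 0"
      using less.prems(2) by (simp only: H_diff)
    have supp: "\<delta> k i = 0" if "k < m" "i < R" "0 < \<nu> i" "G \<mu> k = 0" for k i
    proof -
      have "(\<Sum>i<R. \<nu> i * \<delta> k i) = 0"
        using \<nu>(2) that by (simp add: G_def)
      moreover have "\<forall>x\<in>{..<R}. 0 \<le> \<nu> x * \<delta> k x"
        using \<nu>(1) nonneg that(1) by simp
      ultimately have "\<forall>x\<in>{..<R}. \<nu> x * \<delta> k x = 0"
        using sum_nonneg_eq_0_iff[of "{..<R}" "\<lambda>x. \<nu> x * \<delta> k x"] by blast
      then have "\<nu> i * \<delta> k i = 0"
        using that(2) by blast
      then show ?thesis using that(3) by simp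
    qed
    have "G \<nu> k0 \<noteq> 0"
      using \<nu>(2) k0 by simp
    then obtain i where i: "i < R" "\<nu> i * \<delta> k0 i \<noteq> 0"
      unfolding G_def by (meson lessThan_iff sum.not_neutral_contains_not_neutral)
    then have "0 < \<nu> i"
      using \<nu>(1) by (auto simp: less_le)
    \<comment> \<open>Pick an old ray i in the support of \<nu>. If it lies on the hyperplane,
      \<open>old\<close> applies; otherwise H \<nu> = 0 forces a ray j of the opposite sign into the
      support, and \<open>new\<close> applies to the pair.\<close>
    have "\<exists>f<n. \<forall>k<m. G \<mu> k = 0 \<longrightarrow> G (\<rho> f) k = 0"
    proof (cases "D i" "0 :: real" rule: linorder_cases)
      case equal
      then show ?thesis
        using old[OF i(1)] supp i(1) \<open>0 < \<nu> i\<close> by meson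
    next
      case less
      have "\<exists>j<R. 0 < \<nu> j \<and> 0 < D j"
      proof (rule ccontr)
        assume neg: "\<not> ?thesis"
        have "\<nu> j * D j \<le> 0" if "j < R" for j
        proof (cases "0 < D j")
          case True
          then have "\<not> 0 < \<nu> j"
            using neg that by blast
          moreover have "0 \<le> \<nu> j"
            using \<nu>(1) that by blast
          ultimately show ?thesis by simp
        next
          case False
          then show ?thesis
            using \<nu>(1) that by (simp add: mult_nonneg_nonpos)
        qed
        moreover have "\<nu> i * D i < 0"
          using \<open>0 < \<nu> i\<close> less by (simp add: mult_pos_neg)
        ultimately have "H \<nu> < (\<Sum>j<R. 0)"
          unfolding H_def using i(1) by (intro sum_strict_mono_ex1) auto
        then show False using H\<nu> by simp
      qed
      then obtain j where j: "j < R" "0 < \<nu> j" "0 < D j" by blast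
      then obtain f where "f < n" "\<forall>k<m. \<delta> k j = 0 \<and> \<delta> k i = 0 \<longrightarrow> G (\<rho> f) k = 0"
        using new[OF j(1) i(1) j(3) less] by blast
      then show ?thesis
        using supp[OF _ i(1) \<open>0 < \<nu> i\<close>] supp[OF _ j(1,2)] by meson
    next
      case greater
      have "\<exists>j<R. 0 < \<nu> j \<and> D j < 0"
      proof (rule ccontr)
        assume neg: "\<not> ?thesis"
        have "0 \<le> \<nu> j * D j" if "j < R" for j
        proof (cases "D j < 0")
          case True
          then have "\<not> 0 < \<nu> j"
            using neg that by blast
          moreover have "0 \<le> \<nu> j"
            using \<nu>(1) that by blast
          ultimately show ?thesis by simp
        next
          case False
          then show ?thesis
            using \<nu>(1) that by simp
        qed
        moreover have "0 < \<nu> i * D i"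
          using \<open>0 < \<nu> i\<close> greater by simp
        ultimately have "(\<Sum>j<R. 0) < H \<nu>"
          unfolding H_def using i(1) by (intro sum_strict_mono_ex1) auto
        then show False using H\<nu> by simp
      qed
      then obtain j where j: "j < R" "0 < \<nu> j" "D j < 0" by blast
      then obtain f where "f < n" "\<forall>k<m. \<delta> k i = 0 \<and> \<delta> k j = 0 \<longrightarrow> G (\<rho> f) k = 0"
        using new[OF i(1) j(1) greater j(3)] by blast
      then show ?thesis
        using supp[OF _ i(1) \<open>0 < \<nu> i\<close>] supp[OF _ j(1,2)] by meson
    qed
    then obtain f where f: "f < n" "\<forall>k<m. G \<mu> k = 0 \<longrightarrow> G (\<rho> f) k = 0"
      by blast
    define K where "K = {k. k < m \<and> G (\<rho> f) k \<noteq> 0}"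
    define a where "a = Min ((\<lambda>k. G \<mu> k / G (\<rho> f) k) ` K)"
    have K: "finite K" "K \<noteq> {}"
      using ray(3)[OF f(1)] by (auto simp: K_def)
    have Kpos: "0 < G (\<rho> f) k" "0 < G \<mu> k" if "k \<in> K" for k
      using that f ray(2)[OF f(1)] less.prems(1) by (auto simp: K_def less_le)
    have "a \<in> (\<lambda>k. G \<mu> k / G (\<rho> f) k) ` K"
      unfolding a_def using K by (intro Min_in) auto
    then obtain k1 where k1: "k1 \<in> K" "a = G \<mu> k1 / G (\<rho> f) k1"
      by blast
    have a: "0 < a"
      using k1 Kpos by simp
    have a_le: "a * G (\<rho> f) k \<le> G \<mu> k" if "k < m" for k
    proof (cases "k \<in> K")
      case True
      then have "a \<le> G \<mu> k / G (\<rho> f) k"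
        unfolding a_def using K by (intro Min_le) auto
      then show ?thesis
        using Kpos(1)[OF True] by (simp add: pos_le_divide_eq)
    next
      case False
      then show ?thesis
        using that less.prems(1) by (simp add: K_def)
    qed
    let ?\<mu> = "\<lambda>i. \<mu> i - a * \<rho> f i"
    have "{k. k < m \<and> G ?\<mu> k \<noteq> 0} \<subset> {k. k < m \<and> G \<mu> k \<noteq> 0}"
    proof (rule psubsetI)
      show "{k. k < m \<and> G ?\<mu> k \<noteq> 0} \<subseteq> {k. k < m \<and> G \<mu> k \<noteq> 0}"
        using f(2) by (auto simp: G_diff)
      have "G ?\<mu> k1 = G \<mu> k1 - a * G (\<rho> f) k1"
        by (rule G_diff)
      then have "G ?\<mu> k1 = 0"
        using k1(2) Kpos(1)[OF k1(1)] by simp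
      then have "k1 \<in> {k. k < m \<and> G \<mu> k \<noteq> 0}" "k1 \<notin> {k. k < m \<and> G ?\<mu> k \<noteq> 0}"
        using k1(1) Kpos[OF k1(1)] by (simp_all add: K_def)
      then show "{k. k < m \<and> G ?\<mu> k \<noteq> 0} \<noteq> {k. k < m \<and> G \<mu> k \<noteq> 0}"
        by blast
    qed
    then have "card {k. k < m \<and> G ?\<mu> k \<noteq> 0} < card {k. k < m \<and> G \<mu> k \<noteq> 0}"
      by (intro psubset_card_mono) auto
    moreover have "\<forall>k<m. 0 \<le> G ?\<mu> k"
      using a_le by (simp add: G_diff)
    moreover have "H ?\<mu> = 0"
      using less.prems(2) ray(1)[OF f(1)] by (simp add: H_diff)
    ultimately obtain c where c: "\<forall>f<n. 0 \<le> c f" "\<forall>k<m. G ?\<mu> k = (\<Sum>f<n. c f * G (\<rho> f) k)"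
      using less.hyps by blast
    have "G \<mu> k = (\<Sum>g<n. (c g + (if g = f then a else 0)) * G (\<rho> g) k)" if "k < m" for k
    proof -
      have "(\<Sum>g<n. (c g + (if g = f then a else 0)) * G (\<rho> g) k) =
          (\<Sum>g<n. c g * G (\<rho> g) k) + (\<Sum>g<n. if g = f then a * G (\<rho> g) k else 0)"
        unfolding sum.distrib[symmetric] by (intro sum.cong) (auto simp: distrib_right)
      also have "\<dots> = G ?\<mu> k + a * G (\<rho> f) k"
        using c(2) that f(1) by simp
      finally show ?thesis
        by (simp add: G_diff)
    qed
    then show ?thesis
      using c(1) a by (intro exI[of _ "\<lambda>g. c g + (if g = f then a else 0)"]) auto
  qed
qed

section \<open>New rays as points of the old cone\<close>

definition valid_ray :: "nat \<Rightarrow> ray \<Rightarrow> bool" where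
  "valid_ray R e = (case e of Old i \<Rightarrow> i < R | Sum i j \<Rightarrow> i < R \<and> j < R
    | Comb i x j y \<Rightarrow> i < R \<and> j < R \<and> 0 < x \<and> 0 < y)"

definition ray_weight :: "ray \<Rightarrow> nat \<Rightarrow> real" where
  "ray_weight e t = (case e of Old i \<Rightarrow> of_bool (t = i)
    | Sum i j \<Rightarrow> of_bool (t = i) + of_bool (t = j)
    | Comb i x j y \<Rightarrow> of_int x * of_bool (t = i) + of_int y * of_bool (t = j))"

lemma dot_ray_weight:
  assumes "valid_ray R e" "length v = R"
  shows "dot (ray_weight e) v = real_of_int (ray_entry e v)"
proof -
  have unit: "(\<Sum>t<R. c * of_bool (t = i) * real_of_int (v ! t)) = c * real_of_int (v ! i)"
    if "i < R" for i and c :: real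
  proof -
    have "(\<Sum>t<R. c * of_bool (t = i) * real_of_int (v ! t)) =
        (\<Sum>t<R. if t = i then c * real_of_int (v ! t) else 0)"
      by (intro sum.cong) auto
    then show ?thesis using that by simp
  qed
  show ?thesis
    using assms unit[of _ 1] unit
    by (cases e) (auto simp: dot_def valid_ray_def ray_weight_def distrib_right sum.distrib)
qed

lemma length_eq_cols:
  "length v = R \<Longrightarrow> length w = R \<Longrightarrow> length P = R \<Longrightarrow> length (eq_cols v w P) = R"
  by (induction v w P arbitrary: R rule: eq_cols.induct) auto

lemma nth_eq_cols:
  "i < length v \<Longrightarrow> length w = length v \<Longrightarrow> length P = length v \<Longrightarrow>
    eq_cols v w P ! i = (v ! i = w ! i) # P ! i"
  by (induction v w P arbitrary: i rule: eq_cols.induct) (auto simp: nth_Cons split: nat.split)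

lemma patterns:
  assumes "\<forall>v\<in>set Z. length v = R" "Z \<noteq> []"
  shows "length (patterns Z) = R \<and>
    (\<forall>i<R. patterns Z ! i = map (\<lambda>k. Z ! k ! i = Z ! Suc k ! i) [0..<length Z - 1])"
  using assms
proof (induction Z rule: patterns.induct)
  case (1 v w ws)
  then have IH: "length (patterns (w # ws)) = R"
    "\<forall>i<R. patterns (w # ws) ! i = map (\<lambda>k. (w # ws) ! k ! i = (w # ws) ! Suc k ! i) [0..<length ws]"
    by auto
  have up: "[0..<Suc (length ws)] = 0 # map Suc [0..<length ws]"
    by (simp add: upt_conv_Cons map_Suc_upt del: upt_Suc)
  show ?case
    using 1 IH up by (auto simp: length_eq_cols nth_eq_cols simp del: upt_Suc)
qed auto

lemma split_rays:
  assumes "length xs = length ps" "split_rays i xs ps zs us vs = (zs', us', vs')"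
  shows "(\<forall>q e. (q, e) \<in> set zs' \<longleftrightarrow> (q, e) \<in> set zs \<or> (\<exists>t<length xs. xs ! t = 0 \<and> q = ps ! t \<and> e = Old (i + t))) \<and>
    (\<forall>q j x. (q, j, x) \<in> set us' \<longleftrightarrow> (q, j, x) \<in> set us \<or>
      (\<exists>t<length xs. 0 < xs ! t \<and> q = ps ! t \<and> j = i + t \<and> x = xs ! t)) \<and>
    (\<forall>q j x. (q, j, x) \<in> set vs' \<longleftrightarrow> (q, j, x) \<in> set vs \<or>
      (\<exists>t<length xs. xs ! t < 0 \<and> q = ps ! t \<and> j = i + t \<and> x = - xs ! t))"
  using assms
proof (induction xs ps arbitrary: i zs us vs rule: list_induct2)
  case Nil
  then show ?case by simp
next
  case (Cons x xs p ps)
  note ex = Ex_less_Suc2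
  consider "x = 0" | "0 < x" | "x < 0" by linarith
  then show ?case
  proof cases
    case 1
    with Cons.prems have "split_rays (Suc i) xs ps ((p, Old i) # zs) us vs = (zs', us', vs')" by simp
    note IH = Cons.IH[OF this]
    show ?thesis using IH 1 by (simp add: ex) blast
  next
    case 2
    with Cons.prems have "split_rays (Suc i) xs ps zs ((p, i, x) # us) vs = (zs', us', vs')" by simp
    note IH = Cons.IH[OF this]
    show ?thesis using IH 2 by (simp add: ex) blast
  next
    case 3
    with Cons.prems have "split_rays (Suc i) xs ps zs us ((p, i, - x) # vs) = (zs', us', vs')" by simp
    note IH = Cons.IH[OF this]
    show ?thesis using IH 3 by (simp add: ex) blast
  qed
qed

lemma set_combine1:
  "set (combine1 p i x vs zs) = set zs \<union> (\<lambda>(q, j, y). (band p q, mk_ray i y j x)) ` set vs"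
  by (induction p i x vs zs rule: combine1.induct) auto

lemma set_combine:
  "set (combine us vs zs) = set zs \<union>
    (\<Union>(p, i, x)\<in>set us. (\<lambda>(q, j, y). (band p q, mk_ray i y j x)) ` set vs)"
  by (induction us vs zs rule: combine.induct) (auto simp: set_combine1)

lemma covers_iff:
  "length p = length q \<Longrightarrow> covers p q \<longleftrightarrow> (\<forall>k<length p. q ! k \<longrightarrow> p ! k)"
  by (induction p q rule: list_induct2) (auto simp: All_less_Suc2)

lemma nth_band: "k < length p \<Longrightarrow> length q = length p \<Longrightarrow> band p q ! k = (p ! k \<and> q ! k)"
  by (induction p q arbitrary: k rule: band.induct) (auto simp: nth_Cons split: nat.split)

lemma length_band [simp]: "length (band p q) = min (length p) (length q)"
  by (induction p q rule: band.induct) auto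

lemma any_covers_iff: "any_covers p es \<longleftrightarrow> (\<exists>(q, e)\<in>set es. covers q p)"
  by (induction p es rule: any_covers.induct) auto

lemma set_drop_covered: "set (drop_covered p es) = {(q, e) \<in> set es. \<not> covers p q}"
  by (induction p es rule: drop_covered.induct) auto

text \<open>A discarded ray is always represented by a survivor with at least its coincidences.
  Covering is transitive among patterns of equal length, so representation persists when a
  representative is itself replaced.\<close>

lemma extreme:
  assumes "\<forall>(p, e)\<in>set ks \<union> set es. length p = m"
  shows "set (extreme ks es) \<subseteq> set ks \<union> set es \<and>
    (\<forall>(p, e)\<in>set ks \<union> set es. \<exists>(q, f)\<in>set (extreme ks es). covers q p)"
  using assms
proof (induction ks es rule: extreme.induct)
  case (1 ks)
  have "\<exists>(q, f)\<in>set ks. covers q p" if "(p, e) \<in> set ks" for p e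
    using that by (intro bexI[of _ "(p, e)"]) (simp_all add: covers_iff)
  then show ?case by auto
next
  case (2 ks p e es)
  have trans: "covers a c" if "covers a b" "covers b c" "length a = m" "length b = m" "length c = m" for a b c
    using that by (simp add: covers_iff)
  show ?case
  proof (cases "any_covers p ks")
    case True
    then have IH: "set (extreme ks es) \<subseteq> set ks \<union> set es"
      "\<forall>(p, e)\<in>set ks \<union> set es. \<exists>(q, f)\<in>set (extreme ks es). covers q p"
      using "2.IH"(1) "2.prems" by auto
    obtain q f where q: "(q, f) \<in> set ks" "covers q p"
      using True by (auto simp: any_covers_iff)
    obtain r g where r: "(r, g) \<in> set (extreme ks es)" "covers r q"
      using IH(2) q(1) by fastforce
    have "length p = m" "length q = m" "length r = m"
      using "2.prems" q(1) r(1) IH(1) by auto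
    then have "covers r p"
      using trans r(2) q(2) by blast
    then have "\<exists>(q, f)\<in>set (extreme ks es). covers q p"
      using r(1) by blast
    then show ?thesis
      using True IH by auto
  next
    case False
    have IH: "set (extreme ((p, e) # drop_covered p ks) es) \<subseteq> set ((p, e) # drop_covered p ks) \<union> set es"
      "\<forall>(a, b)\<in>set ((p, e) # drop_covered p ks) \<union> set es.
        \<exists>(q, f)\<in>set (extreme ((p, e) # drop_covered p ks) es). covers q a"
    proof -
      have "\<forall>(q, f)\<in>set ((p, e) # drop_covered p ks) \<union> set es. length q = m"
        using "2.prems" by (auto simp: set_drop_covered)
      note * = "2.IH"(2)[OF False this]
      show "set (extreme ((p, e) # drop_covered p ks) es) \<subseteq> set ((p, e) # drop_covered p ks) \<union> set es"
        by (rule conjunct1[OF *])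
      show "\<forall>(a, b)\<in>set ((p, e) # drop_covered p ks) \<union> set es.
        \<exists>(q, f)\<in>set (extreme ((p, e) # drop_covered p ks) es). covers q a"
        by (rule conjunct2[OF *])
    qed
    obtain r g where r: "(r, g) \<in> set (extreme ((p, e) # drop_covered p ks) es)" "covers r p"
      using IH(2) by fastforce
    have len_r: "length r = m" "length p = m"
      using r(1) IH(1) "2.prems" by (auto simp: set_drop_covered)
    have "\<exists>(q, f)\<in>set (extreme ((p, e) # drop_covered p ks) es). covers q a"
      if a: "(a, b) \<in> set ks \<union> set ((p, e) # es)" for a b
    proof (cases "(a, b) \<in> set ks \<and> covers p a")
      case True
      then have "covers r a"
        using trans[OF r(2)] len_r "2.prems" by auto
      then show ?thesis using r(1) by blast
    next
      case False
      then have "(a, b) \<in> set ((p, e) # drop_covered p ks) \<union> set es"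
        using a by (auto simp: set_drop_covered)
      then show ?thesis using IH(2) by blast
    qed
    then show ?thesis
      using False IH(1) by (auto simp: set_drop_covered)
  qed
qed

lemma length_common_zeros:
  "length p = m \<Longrightarrow> \<forall>(q, e)\<in>set es. length q = m \<Longrightarrow> length (common_zeros p es) = m"
  by (induction p es rule: common_zeros.induct) auto

lemma nth_common_zeros:
  "length p = m \<Longrightarrow> \<forall>(q, e)\<in>set es. length q = m \<Longrightarrow> k < m \<Longrightarrow>
    common_zeros p es ! k \<longleftrightarrow> p ! k \<and> (\<forall>(q, e)\<in>set es. q ! k)"
  by (induction p es rule: common_zeros.induct) (auto simp: nth_band)

lemma none_true_iff: "none_true p \<longleftrightarrow> (\<forall>k<length p. \<not> p ! k)"
  by (induction p) (auto simp: All_less_Suc2)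

lemma project_map: "project es v = map (\<lambda>e. ray_entry (snd e) v) es"
  by (induction es v rule: project.induct) auto

lemma project_all_map: "project_all es vs = map (project es) vs"
  by (induction vs) auto

lemma clean:
  "(clean vs out = None \<longrightarrow> (\<exists>v\<in>set vs. \<forall>x\<in>set v. x = 0)) \<and>
   (\<forall>ns. clean vs out = Some ns \<longrightarrow> set ns \<subseteq> set out \<union> vnorm ` set vs)"
proof (induction vs arbitrary: out)
  case Nil
  then show ?case by simp
next
  case (Cons v vs)
  show ?case
    using Cons[of out] Cons[of "vnorm v # out"] vsgn_sound[of Equal v]
    by (cases "vsgn Equal v") auto
qed

section \<open>Gap coordinates\<close>

definition col :: "vec list \<Rightarrow> nat \<Rightarrow> nat \<Rightarrow> vec" where
  "col W R k = (W @ [replicate R 0]) ! k"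

text \<open>The zero vector that \<open>col\<close> appends stands for the minimum, so the last gap
  is the distance from the smallest listed element to it.\<close>

definition gap :: "vec list \<Rightarrow> nat \<Rightarrow> (nat \<Rightarrow> real) \<Rightarrow> nat \<Rightarrow> real" where
  "gap W R \<mu> k = dot \<mu> (col W R k) - dot \<mu> (col W R (Suc k))"

text \<open>
  The last condition says that the columns of \<open>W\<close> generate the whole cone of nonnegative tuples in
  their span; it makes signs on the rays decisive for positive weights.
\<close>

definition tame :: "vec list \<Rightarrow> nat \<Rightarrow> bool" where
  "tame W R \<longleftrightarrow> (\<forall>w\<in>set W. length w = R) \<and>
    (\<forall>k<length W. \<forall>i<R. col W R (Suc k) ! i \<le> col W R k ! i) \<and>
    (\<forall>i<R. \<exists>k<length W. col W R k ! i \<noteq> col W R (Suc k) ! i) \<and>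
    (\<forall>\<mu>. (\<forall>k<length W. 0 \<le> gap W R \<mu> k) \<longrightarrow>
      (\<exists>\<nu>. (\<forall>i<R. 0 \<le> \<nu> i) \<and> (\<forall>k<length W. gap W R \<nu> k = gap W R \<mu> k)))"

text \<open>When the rays are linearly dependent, a point has many weight vectors. These are the
  forms whose value depends on the point alone.\<close>

definition compatible :: "vec list \<Rightarrow> nat \<Rightarrow> vec set" where
  "compatible W R = {v. length v = R \<and> (\<forall>\<mu>. (\<forall>k<length W. gap W R \<mu> k = 0) \<longrightarrow> dot \<mu> v = 0)}"

lemma dot_replicate_0 [simp]: "dot \<mu> (replicate R 0) = 0"
  by (rule dot_0) auto

lemma dot_sub: "dot (\<lambda>i. \<mu> i - a * \<nu> i) v = dot \<mu> v - a * dot \<nu> v"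
  by (simp add: dot_def left_diff_distrib sum_subtractf sum_distrib_left mult.assoc)

lemma gap_sub: "gap W R (\<lambda>i. \<mu> i - a * \<nu> i) k = gap W R \<mu> k - a * gap W R \<nu> k"
  by (simp add: gap_def dot_sub algebra_simps)

lemma length_col: "\<forall>w\<in>set W. length w = R \<Longrightarrow> k \<le> length W \<Longrightarrow> length (col W R k) = R"
  by (auto simp: col_def nth_append)

lemma gap_sum:
  assumes "\<forall>w\<in>set W. length w = R" "k < length W"
  shows "gap W R \<mu> k = (\<Sum>i<R. \<mu> i * real_of_int (col W R k ! i - col W R (Suc k) ! i))"
  using length_col[OF assms(1), of k] length_col[OF assms(1), of "Suc k"] assms(2)
  by (simp add: gap_def dot_def right_diff_distrib sum_subtractf)

lemma dot_col: "k \<le> length W \<Longrightarrow> dot \<mu> (col W R k) = (\<Sum>j\<in>{k..<length W}. gap W R \<mu> j)"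
proof (induction "length W - k" arbitrary: k)
  case 0
  then show ?case by (simp add: col_def nth_append)
next
  case (Suc l)
  then have "dot \<mu> (col W R (Suc k)) = (\<Sum>j\<in>{Suc k..<length W}. gap W R \<mu> j)" "k < length W"
    by auto
  then show ?case
    by (simp add: gap_def sum.atLeast_Suc_lessThan)
qed

lemma compatible_cong:
  assumes "v \<in> compatible W R" "\<forall>k<length W. gap W R \<mu> k = gap W R \<nu> k"
  shows "dot \<mu> v = dot \<nu> v"
proof -
  have "dot (\<lambda>i. \<mu> i - 1 * \<nu> i) v = 0"
    using assms by (auto simp: compatible_def gap_sub simp del: mult_1)
  then show ?thesis
    unfolding dot_sub by simp
qed

lemma set_W_compatible: "\<forall>w\<in>set W. length w = R \<Longrightarrow> set W \<subseteq> compatible W R"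
proof
  fix w assume W: "\<forall>w\<in>set W. length w = R" and "w \<in> set W"
  then obtain k where k: "k < length W" "w = col W R k"
    by (auto simp: in_set_conv_nth col_def nth_append)
  have "dot \<mu> w = (\<Sum>j\<in>{k..<length W}. gap W R \<mu> j)" for \<mu>
    using dot_col k by simp
  then show "w \<in> compatible W R"
    using W \<open>w \<in> set W\<close> by (simp add: compatible_def)
qed

lemma vsub_compatible:
  "v \<in> compatible W R \<Longrightarrow> w \<in> compatible W R \<Longrightarrow> vsub v w \<in> compatible W R"
  by (simp add: compatible_def dot_vsub)

lemma length_vneg: "length (vneg v) = length v"
  by (simp add: vneg_map)

lemma vneg_compatible: "v \<in> compatible W R \<Longrightarrow> vneg v \<in> compatible W R"
  by (simp add: compatible_def dot_vneg length_vneg)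

text \<open>As all gaps are positive, a small multiple of the sum of all rays can be subtracted
  without leaving the cone. The remainder has nonnegative weights by tameness, and adding the
  multiple back makes them positive.\<close>

lemma positive_representation:
  assumes W: "tame W R" and \<mu>: "\<forall>k<length W. 0 < gap W R \<mu> k"
  obtains \<nu> where "\<forall>i<R. 0 < \<nu> i" "\<forall>k<length W. gap W R \<nu> k = gap W R \<mu> k"
proof -
  let ?s = "\<lambda>_::nat. 1 :: real"
  \<comment> \<open>The summand 1 in the denominators avoids division by 0, and the inserted 1 makes
    the set nonempty.\<close>
  define \<epsilon> where "\<epsilon> = Min (insert 1 ((\<lambda>k. gap W R \<mu> k / (1 + gap W R ?s k)) ` {..<length W}))"
  have len: "\<forall>w\<in>set W. length w = R"
    using W by (simp add: tame_def)
  have s: "0 \<le> gap W R ?s k" if "k < length W" for k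
    using W that by (simp add: gap_sum[OF len] tame_def del: of_int_diff) (intro sum_nonneg, simp)
  have "0 < \<epsilon>"
    unfolding \<epsilon>_def using \<mu> s by (subst Min_gr_iff) (auto intro!: divide_pos_pos add_pos_nonneg)
  have "\<epsilon> * gap W R ?s k \<le> gap W R \<mu> k" if "k < length W" for k
  proof -
    have "\<epsilon> \<le> gap W R \<mu> k / (1 + gap W R ?s k)"
      unfolding \<epsilon>_def using that by (intro Min_le) auto
    then have "\<epsilon> * (1 + gap W R ?s k) \<le> gap W R \<mu> k"
      using s[OF that] by (simp add: pos_le_divide_eq)
    then show ?thesis
      using \<open>0 < \<epsilon>\<close> by (simp add: distrib_left)
  qed
  then have "\<forall>k<length W. 0 \<le> gap W R (\<lambda>i. \<mu> i - \<epsilon> * ?s i) k"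
    unfolding gap_sub by simp
  then obtain \<nu> where \<nu>: "\<forall>i<R. 0 \<le> \<nu> i"
    "\<forall>k<length W. gap W R \<nu> k = gap W R (\<lambda>i. \<mu> i - \<epsilon> * ?s i) k"
    using W unfolding tame_def by blast
  show ?thesis
  proof
    \<comment> \<open>The double negation makes adding \<epsilon> an instance of
      \<open>gap_sub\<close>.\<close>
    show "\<forall>i<R. 0 < \<nu> i - (- \<epsilon>) * ?s i"
      using \<nu>(1) \<open>0 < \<epsilon>\<close> by (auto intro: add_nonneg_pos)
    show "\<forall>k<length W. gap W R (\<lambda>i. \<nu> i - (- \<epsilon>) * ?s i) k = gap W R \<mu> k"
      unfolding gap_sub using \<nu>(2) unfolding gap_sub by simp
  qed
qed

section \<open>The section is a cone of the same kind\<close>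

definition zero_pattern :: "vec list \<Rightarrow> nat \<Rightarrow> ray \<Rightarrow> bool list" where
  "zero_pattern W R e = map (\<lambda>k. gap W R (ray_weight e) k = 0) [0..<length W]"

definition good_ray :: "vec \<Rightarrow> vec list \<Rightarrow> nat \<Rightarrow> bool list \<times> ray \<Rightarrow> bool" where
  "good_ray d W R = (\<lambda>(p, e). valid_ray R e \<and> dot (ray_weight e) d = 0 \<and> p = zero_pattern W R e \<and>
    (\<forall>k<length W. 0 \<le> gap W R (ray_weight e) k) \<and> (\<exists>k<length W. gap W R (ray_weight e) k \<noteq> 0))"

lemma length_good_ray: "good_ray d W R (p, e) \<Longrightarrow> length p = length W"
  unfolding good_ray_def zero_pattern_def by clarsimp

lemma gap_ray:
  assumes "\<forall>w\<in>set W. length w = R" "k < length W" "valid_ray R e"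
  shows "gap W R (ray_weight e) k = real_of_int (ray_entry e (col W R k) - ray_entry e (col W R (Suc k)))"
  using assms length_col[OF assms(1), of k] length_col[OF assms(1), of "Suc k"]
  by (simp add: gap_def dot_ray_weight)

text \<open>The three parts supply the hypotheses \<open>ray\<close>, \<open>old\<close> and
  \<open>new\<close> of \<open>conic_generation\<close>.\<close>

lemma rays_sound:
  assumes W: "tame W R" and d: "length d = R"
  shows "(\<forall>pe\<in>set (rays d W). good_ray d W R pe) \<and>
    (\<forall>i<R. d ! i = 0 \<longrightarrow> (\<exists>(p, e)\<in>set (rays d W). \<forall>k<length W.
      col W R k ! i = col W R (Suc k) ! i \<longrightarrow> p ! k)) \<and>
    (\<forall>i<R. \<forall>j<R. 0 < d ! i \<longrightarrow> d ! j < 0 \<longrightarrow> (\<exists>(p, e)\<in>set (rays d W). \<forall>k<length W.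
      col W R k ! i = col W R (Suc k) ! i \<and> col W R k ! j = col W R (Suc k) ! j \<longrightarrow> p ! k))"
proof -
  let ?m = "length W" and ?c = "col W R"
  let ?P = "patterns (W @ [replicate R 0])"
  have len: "\<forall>w\<in>set W. length w = R" and mono: "\<And>k i. k < ?m \<Longrightarrow> i < R \<Longrightarrow> ?c (Suc k) ! i \<le> ?c k ! i"
    and nz: "\<And>i. i < R \<Longrightarrow> \<exists>k<?m. ?c k ! i \<noteq> ?c (Suc k) ! i"
    using W by (simp_all add: tame_def)
  have zero: "map (\<lambda>_. 0) d = replicate R (0 :: int)"
    by (simp add: map_replicate_const d)
  have P: "length ?P = R" "\<And>i. i < R \<Longrightarrow> ?P ! i = map (\<lambda>k. ?c k ! i = ?c (Suc k) ! i) [0..<?m]"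
    using patterns[of "W @ [replicate R 0]" R] len by (auto simp: col_def)
  obtain zs us vs where split: "split_rays 0 d ?P [] [] [] = (zs, us, vs)"
    by (cases "split_rays 0 d ?P [] [] []") auto
  note sp = split_rays[OF _ split, unfolded P(1) d, OF refl, simplified]
  let ?L = "combine us vs zs"
  have mk: "valid_ray R (mk_ray i x j y)" "ray_entry (mk_ray i x j y) v = (if x = y then v ! i + v ! j else x * v ! i + y * v ! j)"
    if "i < R" "j < R" "0 < x" "0 < y" for i x j y v
    using that by (simp_all add: mk_ray_def valid_ray_def)
  have old_good: "good_ray d W R (?P ! i, Old i)" if i: "i < R" "d ! i = 0" for i
  proof -
    have v: "valid_ray R (Old i)"
      using i by (simp add: valid_ray_def)
    show ?thesis
      using v i mono[OF _ i(1)] nz[OF i(1)] P(2)[OF i(1)]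
      by (auto simp: good_ray_def zero_pattern_def dot_ray_weight[OF v d] gap_ray[OF len _ v])
  qed
  have new_good: "good_ray d W R (band (?P ! i) (?P ! j), mk_ray i (- d ! j) j (d ! i))"
    if ij: "i < R" "j < R" "0 < d ! i" "d ! j < 0" for i j
  proof -
    define x y where "x = - d ! j" and "y = d ! i"
    have xy: "0 < x" "0 < y"
      using ij by (simp_all add: x_def y_def)
    let ?e = "mk_ray i x j y"
    have v: "valid_ray R ?e"
      using mk(1)[OF ij(1,2) xy] .
    \<comment> \<open>The weights actually used, after \<open>mk_ray\<close> has dropped a common
      factor.\<close>
    define x' y' where "x' = (if x = y then 1 else x)" and "y' = (if x = y then 1 else y)"
    have xy': "0 < x'" "0 < y'"
      using xy by (simp_all add: x'_def y'_def)
    have g: "gap W R (ray_weight ?e) k =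
        real_of_int (x' * (?c k ! i - ?c (Suc k) ! i) + y' * (?c k ! j - ?c (Suc k) ! j))" if "k < ?m" for k
      using mk(2)[OF ij(1,2) xy]
      by (simp add: gap_ray[OF len that v] x'_def y'_def algebra_simps)
    have nonneg: "0 \<le> x' * (?c k ! i - ?c (Suc k) ! i)" "0 \<le> y' * (?c k ! j - ?c (Suc k) ! j)" if "k < ?m" for k
      using mono[OF that ij(1)] mono[OF that ij(2)] xy' by simp_all
    \<comment> \<open>A sum of two nonnegative terms vanishes only if both do; hence the pattern of
      a combination is the conjunction of the patterns.\<close>
    have g0: "gap W R (ray_weight ?e) k = 0 \<longleftrightarrow> ?c k ! i = ?c (Suc k) ! i \<and> ?c k ! j = ?c (Suc k) ! j"
      if "k < ?m" for k
    proof -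
      have "gap W R (ray_weight ?e) k = 0 \<longleftrightarrow>
          x' * (?c k ! i - ?c (Suc k) ! i) = 0 \<and> y' * (?c k ! j - ?c (Suc k) ! j) = 0"
        unfolding g[OF that] using nonneg[OF that] by linarith
      then show ?thesis using xy' by simp
    qed
    have "ray_entry ?e d = (if x = y then d ! i + d ! j else x * d ! i + y * d ! j)"
      by (rule mk(2)[OF ij(1,2) xy])
    then have "ray_entry ?e d = 0"
      by (simp add: x_def y_def)
    then have "dot (ray_weight ?e) d = 0"
      by (simp add: dot_ray_weight[OF v d])
    moreover have "band (?P ! i) (?P ! j) = zero_pattern W R ?e"
      by (rule nth_equalityI) (simp_all add: P(2) ij zero_pattern_def nth_band g0)
    moreover have "0 \<le> gap W R (ray_weight ?e) k" if "k < ?m" for k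
      unfolding g[OF that] of_int_0_le_iff using nonneg[OF that] by linarith
    moreover have "\<exists>k<?m. gap W R (ray_weight ?e) k \<noteq> 0"
      using nz[OF ij(1)] g0 by blast
    ultimately show ?thesis
      using v by (simp add: good_ray_def x_def y_def)
  qed
  have zs: "(q, e) \<in> set zs \<longleftrightarrow> (\<exists>i<R. d ! i = 0 \<and> q = ?P ! i \<and> e = Old i)" for q e
    using conjunct1[OF sp] by simp
  have us: "(q, i, x) \<in> set us \<longleftrightarrow> i < R \<and> 0 < d ! i \<and> q = ?P ! i \<and> x = d ! i" for q i x
    using conjunct1[OF conjunct2[OF sp]] by auto
  have vs: "(q, j, y) \<in> set vs \<longleftrightarrow> j < R \<and> d ! j < 0 \<and> q = ?P ! j \<and> y = - d ! j" for q j y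
    using conjunct2[OF conjunct2[OF sp]] by auto
  have old_L: "(?P ! i, Old i) \<in> set ?L" if "i < R" "d ! i = 0" for i
    using that zs unfolding set_combine by blast
  have new_L: "(band (?P ! i) (?P ! j), mk_ray i (- d ! j) j (d ! i)) \<in> set ?L"
    if ij: "i < R" "j < R" "0 < d ! i" "d ! j < 0" for i j
  proof -
    have "(?P ! i, i, d ! i) \<in> set us" "(?P ! j, j, - d ! j) \<in> set vs"
      using us vs ij by simp_all
    then show ?thesis
      unfolding set_combine by force
  qed
  have good_L: "good_ray d W R pe" if "pe \<in> set ?L" for pe
  proof -
    have "pe \<in> set zs \<or> (\<exists>p i x q j y. (p, i, x) \<in> set us \<and> (q, j, y) \<in> set vs \<and>
        pe = (band p q, mk_ray i y j x))"
      using that unfolding set_combine by auto blast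
    then show ?thesis
    proof (elim disjE exE conjE)
      assume "pe \<in> set zs"
      moreover obtain q e where "pe = (q, e)"
        by (rule prod.exhaust)
      ultimately show ?thesis
        using zs[of q e] old_good by auto
    next
      fix p i x q j y
      assume "(p, i, x) \<in> set us" "(q, j, y) \<in> set vs" "pe = (band p q, mk_ray i y j x)"
      then show ?thesis
        using us vs new_good by simp
    qed
  qed
  then have len_L: "\<forall>(p, e)\<in>set [] \<union> set ?L. length p = ?m"
    by (auto dest: length_good_ray)
  have rays: "rays d W = extreme [] ?L"
    by (simp add: rays_def zero split)
  have ex: "set (rays d W) \<subseteq> set ?L" "\<And>p e. (p, e) \<in> set ?L \<Longrightarrow> \<exists>(q, f)\<in>set (rays d W). covers q p"
    using extreme[OF len_L] unfolding rays by auto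
  have cov: "\<exists>(q, f)\<in>set (rays d W). \<forall>k<?m. p ! k \<longrightarrow> q ! k" if pe: "(p, e) \<in> set ?L" for p e
  proof -
    obtain q f where q: "(q, f) \<in> set (rays d W)" "covers q p"
      using ex(2)[OF pe] by blast
    have "length q = ?m" "length p = ?m"
      using q(1) ex(1) pe len_L by auto
    then show ?thesis
      using q by (auto simp: covers_iff)
  qed
  have "\<exists>(p, e)\<in>set (rays d W). \<forall>k<?m. ?c k ! i = ?c (Suc k) ! i \<longrightarrow> p ! k" if i: "i < R" "d ! i = 0" for i
  proof -
    from cov[OF old_L[OF i]] show ?thesis
      by (simp add: P(2) i)
  qed
  moreover have "\<exists>(p, e)\<in>set (rays d W). \<forall>k<?m.
      ?c k ! i = ?c (Suc k) ! i \<and> ?c k ! j = ?c (Suc k) ! j \<longrightarrow> p ! k"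
    if ij: "i < R" "j < R" "0 < d ! i" "d ! j < 0" for i j
  proof -
    from cov[OF new_L[OF ij]] show ?thesis
      by (simp add: P(2) ij nth_band)
  qed
  ultimately show ?thesis
    using ex(1) good_L by blast
qed

text \<open>The given point lies on the section, so it has weights on the new rays with unchanged
  gaps. Its positive gaps and nonvanishing excluded forms also show that the branch is not
  pruned.\<close>

lemma restrict_sound:
  assumes W: "tame W R" and d: "d \<in> compatible W R" and ns: "set ns \<subseteq> compatible W R"
    and \<mu>: "\<forall>k<length W. 0 < gap W R \<mu> k" "dot \<mu> d = 0" "\<not> vanishes \<mu> ns"
  obtains W' ns' R' \<mu>' where "restrict d W ns = Some (W', ns')" "tame W' R'" "length W' = length W"
    "set ns' \<subseteq> compatible W' R'" "\<forall>k<length W. gap W' R' \<mu>' k = gap W R \<mu> k" "\<not> vanishes \<mu>' ns'"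
proof -
  let ?m = "length W"
  define es where "es = rays d W"
  define n where "n = length es"
  define \<rho> where "\<rho> f = ray_weight (snd (es ! f))" for f
  define comb where "comb c t = (\<Sum>f<n. c f * \<rho> f t)" for c :: "nat \<Rightarrow> real" and t
  let ?W = "map (project es) W"
  have len: "\<forall>w\<in>set W. length w = R" and len_d: "length d = R"
    using W d by (simp_all add: tame_def compatible_def)
  note rs = rays_sound[OF W len_d, folded es_def]
  have good: "good_ray d W R (es ! f)" if "f < n" for f
    using rs that by (simp add: n_def)
  have valid: "valid_ray R (snd (es ! f))" and ker: "dot (\<rho> f) d = 0"
    and nonneg: "\<And>k. k < ?m \<Longrightarrow> 0 \<le> gap W R (\<rho> f) k" and nonzero: "\<exists>k<?m. gap W R (\<rho> f) k \<noteq> 0"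
    and pat: "fst (es ! f) = zero_pattern W R (snd (es ! f))" if "f < n" for f
    using good[OF that] by (auto simp: good_ray_def \<rho>_def split_beta)
  have dot_comb: "dot (comb c) v = (\<Sum>f<n. c f * dot (\<rho> f) v)" for c v
  proof -
    have "dot (comb c) v = (\<Sum>t<length v. \<Sum>f<n. c f * \<rho> f t * real_of_int (v ! t))"
      by (simp add: dot_def comb_def sum_distrib_right)
    also have "\<dots> = (\<Sum>f<n. \<Sum>t<length v. c f * \<rho> f t * real_of_int (v ! t))"
      by (rule sum.swap)
    finally show ?thesis
      by (simp add: dot_def sum_distrib_left mult.assoc)
  qed
  have dot_project: "dot c (project es v) = dot (comb c) v" if "length v = R" for c v
  proof -
    have "dot c (project es v) = (\<Sum>f<n. c f * real_of_int (ray_entry (snd (es ! f)) v))"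
      by (simp add: dot_def project_map n_def)
    also have "\<dots> = (\<Sum>f<n. c f * dot (\<rho> f) v)"
      by (intro sum.cong refl) (simp add: \<rho>_def dot_ray_weight[OF valid that])
    finally show ?thesis
      by (simp add: dot_comb)
  qed
  have project_0: "project es (replicate R 0) = replicate n 0"
  proof (rule nth_equalityI)
    fix f assume "f < length (project es (replicate R 0))"
    then have f: "f < n" by (simp add: project_map n_def)
    have "real_of_int (ray_entry (snd (es ! f)) (replicate R 0)) = 0"
      using dot_ray_weight[OF valid[OF f], of "replicate R 0"] by simp
    then show "project es (replicate R 0) ! f = replicate n 0 ! f"
      using f by (simp add: project_map n_def)
  qed (simp add: project_map n_def)
  have length_project: "length (project es v) = n" for v
    by (simp add: project_map n_def)
  have col': "col ?W n k = project es (col W R k)" if "k \<le> ?m" for k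
    using that project_0 by (auto simp: col_def nth_append)
  have gap_comb: "gap W R (comb c) k = (\<Sum>f<n. c f * gap W R (\<rho> f) k)" for c k
    by (simp add: gap_def dot_comb right_diff_distrib sum_subtractf)
  have gap': "gap ?W n c k = gap W R (comb c) k" if "k < ?m" for c k
    using that by (simp add: gap_def col' dot_project length_col[OF len])
  \<comment> \<open>Needed twice: to rewrite the given point in the new rays, and to show that the
    new cone is tame again.\<close>
  have gen: "\<exists>c. (\<forall>f<n. 0 \<le> c f) \<and> (\<forall>k<?m. gap W R (comb c) k = gap W R \<nu> k)"
    if \<nu>: "\<forall>k<?m. 0 \<le> gap W R \<nu> k" "dot \<nu> d = 0" for \<nu>
  proof -
    let ?\<delta> = "\<lambda>k i. real_of_int (col W R k ! i - col W R (Suc k) ! i)"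
    let ?D = "\<lambda>i. real_of_int (d ! i)"
    have G: "(\<Sum>i<R. \<nu> i * ?\<delta> k i) = gap W R \<nu> k" if "k < ?m" for \<nu> k
      by (rule gap_sum[OF len that, symmetric])
    have H: "(\<Sum>i<R. \<nu> i * ?D i) = dot \<nu> d" for \<nu>
      by (simp add: dot_def len_d)
    have zero: "p ! k \<longleftrightarrow> gap W R (\<rho> f) k = 0" if "f < n" "es ! f = (p, e)" "k < ?m" for f p e k
      using pat[OF that(1)] that by (simp add: zero_pattern_def \<rho>_def)
    have "\<exists>c. (\<forall>f<n. 0 \<le> c f) \<and>
      (\<forall>k<?m. (\<Sum>i<R. \<nu> i * ?\<delta> k i) = (\<Sum>f<n. c f * (\<Sum>i<R. \<rho> f i * ?\<delta> k i)))"
    proof (rule conic_generation[where D = ?D])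
      show "0 \<le> ?\<delta> k i" if "k < ?m" "i < R" for k i
        using W that by (simp add: tame_def)
      show "\<exists>\<nu>'. (\<forall>i<R. 0 \<le> \<nu>' i) \<and> (\<forall>k<?m. (\<Sum>i<R. \<nu>' i * ?\<delta> k i) = (\<Sum>i<R. \<nu> i * ?\<delta> k i))"
        if "\<forall>k<?m. 0 \<le> (\<Sum>i<R. \<nu> i * ?\<delta> k i)" for \<nu>
        using W that by (simp add: G tame_def del: of_int_diff)
      show "(\<Sum>i<R. \<nu> i * ?D i) = 0" if "\<forall>k<?m. (\<Sum>i<R. \<nu> i * ?\<delta> k i) = 0" for \<nu>
        using d that by (simp add: G H compatible_def del: of_int_diff)
      show "(\<Sum>i<R. \<rho> f i * ?D i) = 0" if "f < n" for f
        using ker[OF that] by (simp add: H)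
      show "0 \<le> (\<Sum>i<R. \<rho> f i * ?\<delta> k i)" if "f < n" "k < ?m" for f k
        using nonneg[OF that] that by (simp add: G del: of_int_diff)
      show "\<exists>k<?m. (\<Sum>i<R. \<rho> f i * ?\<delta> k i) \<noteq> 0" if "f < n" for f
        using nonzero[OF that] by (auto simp: G simp del: of_int_diff)
      show "\<exists>f<n. \<forall>k<?m. ?\<delta> k i = 0 \<longrightarrow> (\<Sum>i<R. \<rho> f i * ?\<delta> k i) = 0" if i: "i < R" "?D i = 0" for i
      proof -
        obtain f p e where f: "f < n" "es ! f = (p, e)"
          "\<forall>k<?m. col W R k ! i = col W R (Suc k) ! i \<longrightarrow> p ! k"
          using rs i unfolding n_def by (auto simp: in_set_conv_nth Bex_def split_beta)
        have "\<forall>k<?m. ?\<delta> k i = 0 \<longrightarrow> gap W R (\<rho> f) k = 0"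
          using f(3) zero[OF f(1,2)] by simp
        then show ?thesis
          using f(1) G by (intro exI[of _ f]) simp
      qed
      show "\<exists>f<n. \<forall>k<?m. ?\<delta> k i = 0 \<and> ?\<delta> k j = 0 \<longrightarrow> (\<Sum>i<R. \<rho> f i * ?\<delta> k i) = 0"
        if ij: "i < R" "j < R" "0 < ?D i" "?D j < 0" for i j
      proof -
        have "\<exists>(p, e)\<in>set es. \<forall>k<?m.
            col W R k ! i = col W R (Suc k) ! i \<and> col W R k ! j = col W R (Suc k) ! j \<longrightarrow> p ! k"
          using conjunct2[OF conjunct2[OF rs]] ij by simp
        then obtain f p e where f: "f < n" "es ! f = (p, e)"
          "\<forall>k<?m. col W R k ! i = col W R (Suc k) ! i \<and> col W R k ! j = col W R (Suc k) ! j \<longrightarrow> p ! k"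
          unfolding n_def by (auto simp: in_set_conv_nth)
        have "\<forall>k<?m. ?\<delta> k i = 0 \<and> ?\<delta> k j = 0 \<longrightarrow> gap W R (\<rho> f) k = 0"
          using f(3) zero[OF f(1,2)] by simp
        then show ?thesis
          using f(1) G by (intro exI[of _ f]) simp
      qed
      show "\<forall>k<?m. 0 \<le> (\<Sum>i<R. \<nu> i * ?\<delta> k i)" "(\<Sum>i<R. \<nu> i * ?D i) = 0"
        using \<nu> by (simp_all add: G H del: of_int_diff)
    qed
    then obtain c where "\<forall>f<n. 0 \<le> c f" "\<forall>k<?m. gap W R \<nu> k = (\<Sum>f<n. c f * gap W R (\<rho> f) k)"
      by (auto simp: G simp del: of_int_diff)
    then show ?thesis
      by (intro exI[of _ c]) (simp add: gap_comb)
  qed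
  have tame': "tame ?W n"
    unfolding tame_def
  proof (intro conjI ballI allI impI)
    show "length w = n" if "w \<in> set ?W" for w
      using that by (auto simp: project_map n_def)
    have nth_project: "project es v ! f = ray_entry (snd (es ! f)) v" if "f < n" for f v
      using that by (simp add: project_map n_def)
    have entry: "col ?W n k ! f - col ?W n (Suc k) ! f =
        ray_entry (snd (es ! f)) (col W R k) - ray_entry (snd (es ! f)) (col W R (Suc k))"
      if "k < ?m" "f < n" for k f
      using that by (simp add: col' nth_project)
    have g: "gap W R (\<rho> f) k = real_of_int (col ?W n k ! f - col ?W n (Suc k) ! f)"
      if "k < ?m" "f < n" for k f
      unfolding entry[OF that] \<rho>_def by (rule gap_ray[OF len that(1) valid[OF that(2)]])
    show "col ?W n (Suc k) ! f \<le> col ?W n k ! f" if "k < length ?W" "f < n" for k f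
      using nonneg[OF that(2), of k] g[of k f] that by simp
    show "\<exists>k<length ?W. col ?W n k ! f \<noteq> col ?W n (Suc k) ! f" if "f < n" for f
      using nonzero[OF that] g that by force
    show "\<exists>\<nu>. (\<forall>i<n. 0 \<le> \<nu> i) \<and> (\<forall>k<length ?W. gap ?W n \<nu> k = gap ?W n c k)"
      if "\<forall>k<length ?W. 0 \<le> gap ?W n c k" for c
    proof -
      \<comment> \<open>Combinations of the new rays stay on the hyperplane even with negative
        weights, so \<open>gen\<close> covers every point of their span with nonnegative
        gaps.\<close>
      have "dot (comb c) d = 0"
        using ker by (simp add: dot_comb)
      then show ?thesis
        using gen[of "comb c"] that by (simp add: gap')
    qed
  qed
  obtain c where c: "\<forall>k<?m. gap W R (comb c) k = gap W R \<mu> k"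
    using gen[of \<mu>] \<mu> by (auto intro: less_imp_le)
  have dot_c: "dot c (project es v) = dot \<mu> v" if "v \<in> compatible W R" for v
    using dot_project[of v c] compatible_cong[OF that c] that by (simp add: compatible_def)
  have project_compatible: "project es v \<in> compatible ?W n" if "v \<in> compatible W R" for v
    using that by (auto simp: compatible_def gap' dot_project length_project)
  have "none_true (common_zeros (map (\<lambda>_. True) W) es)"
  proof -
    have lens: "\<forall>(q, e)\<in>set es. length q = ?m"
      using conjunct1[OF rs] by (auto dest!: bspec length_good_ray)
    have "\<exists>(q, e)\<in>set es. \<not> q ! k" if k: "k < ?m" for k
    proof -
      have "0 < gap W R (comb c) k"
        using c \<mu>(1) k by simp
      then have "(\<Sum>f<n. c f * gap W R (\<rho> f) k) \<noteq> 0"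
        by (simp add: gap_comb)
      then have "\<exists>f<n. gap W R (\<rho> f) k \<noteq> 0"
        by (rule contrapos_np) (intro sum.neutral, auto)
      then obtain f where f: "f < n" "gap W R (\<rho> f) k \<noteq> 0"
        by blast
      then have "\<not> fst (es ! f) ! k"
        using pat[OF f(1)] k by (simp add: zero_pattern_def \<rho>_def)
      then show ?thesis
        using f(1) by (intro bexI[of _ "es ! f"]) (simp_all add: split_beta n_def)
    qed
    then show ?thesis
      using lens by (simp add: none_true_iff length_common_zeros[of _ ?m] nth_common_zeros[of _ ?m]) blast
  qed
  then have r: "restrict d W ns = map_option (Pair ?W) (clean (map (project es) ns) [])"
    by (simp add: restrict_def es_def project_all_map Let_def)
  have "clean (map (project es) ns) [] \<noteq> None"
  proof
    assume "clean (map (project es) ns) [] = None"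
    then obtain v where v: "v \<in> set ns" "\<forall>x\<in>set (project es v). x = 0"
      using clean[of "map (project es) ns" "[]"] by auto
    then have "dot \<mu> v = 0"
      using dot_0[of "project es v" c] dot_c[of v] ns by auto
    then show False
      using \<mu>(3) v(1) by (auto simp: vanishes_def)
  qed
  then obtain ns' where ns': "clean (map (project es) ns) [] = Some ns'"
    by blast
  then have sub: "set ns' \<subseteq> vnorm ` project es ` set ns"
    using clean[of "map (project es) ns" "[]"] by simp
  show ?thesis
  proof
    show "restrict d W ns = Some (?W, ns')"
      by (simp add: r ns')
    show "set ns' \<subseteq> compatible ?W n"
      using sub ns project_compatible vneg_compatible by (fastforce simp: vnorm_def)
    show "\<not> vanishes c ns'"
      unfolding vanishes_def
    proof
      assume "\<exists>v\<in>set ns'. dot c v = 0"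
      then obtain w where w: "w \<in> set ns" "dot c (vnorm (project es w)) = 0"
        using sub by blast
      then have "dot \<mu> w = 0"
        using dot_c[of w] ns by (auto simp: dot_vnorm_eq_0)
      then show False
        using w(1) \<mu>(3) by (auto simp: vanishes_def)
    qed
  qed (use tame' gap' c in simp_all)
qed

subsection \<open>Soundness of the search\<close>

lemma search_all_sound:
  assumes "search_all f W ds ns" and W: "tame W R" and \<mu>: "\<forall>k<length W. 0 < gap W R \<mu> k"
    and "set ds \<subseteq> compatible W R" "set ns \<subseteq> compatible W R" "\<not> vanishes \<mu> ns" "vanishes \<mu> ds"
    and step: "\<And>W' ns' R' \<mu>'. f W' ns' \<Longrightarrow> tame W' R' \<Longrightarrow> length W' = length W \<Longrightarrow>
      set ns' \<subseteq> compatible W' R' \<Longrightarrow> \<forall>k<length W. gap W' R' \<mu>' k = gap W R \<mu> k \<Longrightarrow>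
      \<not> vanishes \<mu>' ns' \<Longrightarrow> Q"
  shows Q
  using assms(1,4-7)
proof (induction ds arbitrary: ns)
  case Nil
  then show ?case by (simp add: vanishes_def)
next
  case (Cons d ds)
  show ?case
  proof (cases "dot \<mu> d = 0")
    case True
    have "d \<in> compatible W R"
      using Cons.prems by simp
    then obtain W' ns' R' \<mu>' where r: "restrict d W ns = Some (W', ns')" "tame W' R'" "length W' = length W"
      "set ns' \<subseteq> compatible W' R'" "\<forall>k<length W. gap W' R' \<mu>' k = gap W R \<mu> k" "\<not> vanishes \<mu>' ns'"
      using restrict_sound[OF W _ Cons.prems(3) \<mu> True Cons.prems(4)] by metis
    then have "f W' ns'"
      using Cons.prems(1) by simp
    then show ?thesis
      using r(2-6) by (rule step)
  next
    case False
    show ?thesis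
    proof (rule Cons.IH)
      show "search_all f W ds (d # ns)"
        using Cons.prems(1) by simp
    qed (use Cons.prems False in \<open>auto simp: vanishes_def\<close>)
  qed
qed

lemma map_dot_eq:
  assumes "\<forall>w\<in>set W. length w = R"
  shows "map (dot \<mu>) W = map (\<lambda>k. \<Sum>j\<in>{k..<length W}. gap W R \<mu> j) [0..<length W]"
proof (rule nth_equalityI)
  fix k assume "k < length (map (dot \<mu>) W)"
  then show "map (dot \<mu>) W ! k = map (\<lambda>k. \<Sum>j\<in>{k..<length W}. gap W R \<mu> j) [0..<length W] ! k"
    using dot_col[of k W \<mu> R] by (simp add: col_def nth_append)
qed simp

lemma map_dot_cong:
  assumes "tame W R" "tame W' R'" "length W' = length W" "\<forall>k<length W. gap W' R' \<mu>' k = gap W R \<mu> k"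
  shows "map (dot \<mu>') W' = map (dot \<mu>) W"
proof -
  have "(\<Sum>j\<in>{k..<length W}. gap W' R' \<mu>' j) = (\<Sum>j\<in>{k..<length W}. gap W R \<mu> j)" for k
    using assms(4) by (intro sum.cong) auto
  then show ?thesis
    using assms by (simp add: map_dot_eq[of W R] map_dot_eq[of W' R'] tame_def)
qed

text \<open>Weights change at every node, but the list of element values does not. At each node
  strictly positive weights are chosen first, since signs on rays are decisive only for
  those.\<close>

lemma search_sound:
  assumes "search n W ns" "tame W R" "set ns \<subseteq> compatible W R" "\<forall>k<length W. 0 < gap W R \<mu> k"
    "\<not> vanishes \<mu> ns" "mstd (insert 0 (set (map (dot \<mu>) W)))" "W \<noteq> []"
    and H: "\<And>B :: real set. card B = length W \<Longrightarrow> \<not> mstd B"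
  shows "\<exists>W' \<mu>'. terminal W' \<and> length W' = length W \<and> map (dot \<mu>') W' = map (dot \<mu>) W"
  using assms
proof (induction n arbitrary: W ns R \<mu>)
  case 0
  then show ?case by simp
next
  case (Suc n)
  obtain \<nu> where \<nu>: "\<forall>i<R. 0 < \<nu> i" "\<forall>k<length W. gap W R \<nu> k = gap W R \<mu> k"
    using positive_representation[OF Suc.prems(2,4)] .
  have lens: "\<forall>w\<in>set W. length w = R"
    using Suc.prems(2) by (simp add: tame_def)
  have eq: "map (dot \<nu>) W = map (dot \<mu>) W"
    using map_dot_cong[OF Suc.prems(2,2) refl \<nu>(2)] .
  interpret positive_weights \<nu> R "compatible W R"
    by unfold_locales (use \<nu>(1) vsub_compatible vneg_compatible in \<open>auto simp: compatible_def\<close>)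
  have gap_pos: "\<forall>k<length W. 0 < gap W R \<nu> k"
    using \<nu>(2) Suc.prems(4) by simp
  have value_sum: "val (W ! k) = (\<Sum>j\<in>{k..<length W}. gap W R \<nu> j)" if "k < length W" for k
    using arg_cong[OF map_dot_eq[OF lens, of \<nu>], of "\<lambda>xs. xs ! k"] that by simp
  have positive: "0 < val w" if w: "w \<in> set W" for w
  proof -
    obtain k where k: "k < length W" "w = W ! k"
      using w by (auto simp: in_set_conv_nth)
    have "0 < (\<Sum>j\<in>{k..<length W}. gap W R \<nu> j)"
      using k gap_pos by (intro sum_pos) auto
    then show ?thesis
      using value_sum k by simp
  qed
  have desc: "descending W"
    unfolding sorted_wrt_iff_nth_less
  proof (intro allI impI)
    fix i j assume ij: "i < j" "j < length W"
    have "(\<Sum>j\<in>{i..<length W}. gap W R \<nu> j) =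
        (\<Sum>j\<in>{i..<j}. gap W R \<nu> j) + (\<Sum>j\<in>{j..<length W}. gap W R \<nu> j)"
      using ij by (simp add: sum.atLeastLessThan_concat)
    moreover have "0 < (\<Sum>j\<in>{i..<j}. gap W R \<nu> j)"
      using ij gap_pos by (intro sum_pos) auto
    ultimately show "val (W ! j) < val (W ! i)"
      using ij by (simp add: value_sum)
  qed
  have nv: "\<not> vanishes \<nu> ns"
    using Suc.prems(3,5) compatible_cong[OF _ \<nu>(2)] by (auto simp: vanishes_def subset_iff)
  show ?case
  proof (cases "branch W ns")
    case None
    then have "terminal W"
      using Suc.prems(1) by simp
    then show ?thesis by blast
  next
    case (Some ds)
    have "mstd (insert 0 (val ` set W))"
      using Suc.prems(6) eq by (metis list.set_map)
    then have ds: "set ds \<subseteq> compatible W R" "vanishes \<nu> ds"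
      using branch_sound[OF set_W_compatible[OF lens] desc positive Suc.prems(7) _ Suc.prems(8) nv Some]
      by simp_all
    have "search_all (search n) W ds ns"
      using Suc.prems(1) Some by simp
    then show ?thesis
    proof (rule search_all_sound[OF _ Suc.prems(2) gap_pos ds(1) Suc.prems(3) nv ds(2)])
      fix W' ns' R' \<mu>'
      assume s: "search n W' ns'" "tame W' R'" and l: "length W' = length W"
        and ns': "set ns' \<subseteq> compatible W' R'" and g: "\<forall>k<length W. gap W' R' \<mu>' k = gap W R \<nu> k"
        and nv': "\<not> vanishes \<mu>' ns'"
      have eq': "map (dot \<mu>') W' = map (dot \<mu>) W"
        using map_dot_cong[OF Suc.prems(2) s(2) l g] eq by simp
      have "\<exists>W'' \<mu>''. terminal W'' \<and> length W'' = length W' \<and> map (dot \<mu>'') W'' = map (dot \<mu>') W'"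
      proof (rule Suc.IH[OF s ns' _ nv'])
        show "\<forall>k<length W'. 0 < gap W' R' \<mu>' k"
          using g gap_pos l by simp
        show "mstd (insert 0 (set (map (dot \<mu>') W')))"
          unfolding eq' by (rule Suc.prems(6))
        show "W' \<noteq> []"
          using l Suc.prems(7) by auto
        show "\<And>B :: real set. card B = length W' \<Longrightarrow> \<not> mstd B"
          using Suc.prems(8) l by simp
      qed
      then show "\<exists>W' \<mu>'. terminal W' \<and> length W' = length W \<and> map (dot \<mu>') W' = map (dot \<mu>) W"
        using l eq' by simp
    qed
  qed
qed

section \<open>From terminal lists to sets of reals\<close>

lemma scalars: "length (scalars W) \<le> length W \<and>
    (length (scalars W) = length W \<longrightarrow> W = map (\<lambda>x. [x]) (scalars W))"
  by (induction W rule: scalars.induct) auto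

lemma scale_map: "scale c xs = map ((*) c) xs"
  by (induction c xs rule: scale.induct) auto

lemma terminal_values:
  assumes "terminal W" "length W \<le> 7"
  shows "\<exists>t. map (dot \<mu>) W = map (\<lambda>k. of_int k * t) [14, 12, 11, 7, 4, 3, 2] \<or>
    map (dot \<mu>) W = map (\<lambda>k. of_int k * t) [14, 12, 11, 10, 7, 3, 2]"
proof -
  have "scalars W \<noteq> []"
    using assms(1) by (auto simp: terminal_def)
  then obtain x xs where s: "scalars W = x # xs"
    by (cases "scalars W") simp_all
  obtain K where K: "map ((*) 14) (scalars W) = map ((*) x) K"
    "K = [14, 12, 11, 7, 4, 3, 2] \<or> K = [14, 12, 11, 10, 7, 3, 2]"
    using assms(1) unfolding terminal_def s list.case scale_map by blast
  \<comment> \<open>As \<open>W\<close> has at most seven entries, nothing was cut off and all its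
    vectors are single numbers.\<close>
  have "length (scalars W) = 7"
    using arg_cong[OF K(1), of length] K(2) by auto
  then have W: "W = map (\<lambda>x. [x]) (scalars W)"
    using scalars[of W] assms(2) by linarith
  have "map (dot \<mu>) W = map (\<lambda>y. \<mu> 0 * of_int y) (scalars W)"
    by (subst W) (simp add: dot_def)
  also have "\<dots> = map (\<lambda>y. \<mu> 0 / 14 * of_int y) (map ((*) 14) (scalars W))"
    by simp
  also have "\<dots> = map (\<lambda>k. of_int k * (\<mu> 0 / 14 * of_int x)) K"
    unfolding K(1) by (simp add: mult_ac)
  finally show ?thesis
    using K(2) by blast
qed

text \<open>The cone of all increasing tuples, with the gaps between neighbours as coordinates.\<close>

definition init :: "nat \<Rightarrow> vec list" where
  "init m = map (\<lambda>k. replicate (m - k) 1 @ replicate k 0) [0..<m]"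

lemma col_init: "k \<le> m \<Longrightarrow> col (init m) m k = replicate (m - k) 1 @ replicate k 0"
  by (auto simp: col_def init_def nth_append)

lemma length_init [simp]: "length (init m) = m"
  by (simp add: init_def)

lemma dot_init: "k \<le> m \<Longrightarrow> dot \<mu> (replicate (m - k) 1 @ replicate k 0) = (\<Sum>i<m - k. \<mu> i)"
proof -
  assume k: "k \<le> m"
  have "dot \<mu> (replicate (m - k) 1 @ replicate k 0) = (\<Sum>i<m. if i < m - k then \<mu> i else 0)"
    using k by (auto simp: dot_def nth_append intro!: sum.cong)
  also have "\<dots> = (\<Sum>i\<in>{..<m} \<inter> {i. i < m - k}. \<mu> i)"
    by (simp add: sum.inter_restrict)
  also have "{..<m} \<inter> {i. i < m - k} = {..<m - k}"
    by auto
  finally show ?thesis .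
qed

lemma gap_init: "k < m \<Longrightarrow> gap (init m) m \<mu> k = \<mu> (m - Suc k)"
proof -
  assume k: "k < m"
  have "gap (init m) m \<mu> k = (\<Sum>i<m - k. \<mu> i) - (\<Sum>i<m - Suc k. \<mu> i)"
    using dot_init[of k m \<mu>] dot_init[of "Suc k" m \<mu>] k by (simp add: gap_def col_init)
  also have "m - k = Suc (m - Suc k)"
    using k by simp
  finally show ?thesis
    by simp
qed

lemma tame_init: "tame (init m) m"
  unfolding tame_def
proof (intro conjI ballI allI impI)
  show "length w = m" if "w \<in> set (init m)" for w
    using that by (auto simp: init_def)
  show "col (init m) m (Suc k) ! i \<le> col (init m) m k ! i" if "k < length (init m)" "i < m" for k i
    using that by (auto simp: col_init nth_append)
  show "\<exists>k<length (init m). col (init m) m k ! i \<noteq> col (init m) m (Suc k) ! i" if "i < m" for i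
    using that by (intro exI[of _ "m - Suc i"]) (simp add: col_init nth_append del: replicate.simps)
  show "\<exists>\<nu>. (\<forall>i<m. 0 \<le> \<nu> i) \<and> (\<forall>k<length (init m). gap (init m) m \<nu> k = gap (init m) m \<mu> k)"
    if nonneg: "\<forall>k<length (init m). 0 \<le> gap (init m) m \<mu> k" for \<mu>
  proof -
    have "0 \<le> \<mu> i" if i: "i < m" for i
      using nonneg[rule_format, of "m - Suc i"] i by (simp add: gap_init)
    then show ?thesis by blast
  qed
qed

lemma mstd_of_search:
  assumes "search n (init m) []" and m: "0 < m" and H: "\<And>B :: real set. card B = m \<Longrightarrow> \<not> mstd B"
    and A: "mstd A" "card A = Suc m"
  shows "\<exists>W \<mu> a. terminal W \<and> length W = m \<and> A = (+) (a :: real) ` insert 0 (set (map (dot \<mu>) W))"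
proof -
  define l where "l = sorted_list_of_set A"
  have fin: "finite A"
    using A(1) by (simp add: mstd_def)
  have l: "set l = A" "length l = Suc m" "sorted_wrt (<) l"
    using fin A(2) by (simp_all add: l_def)
  \<comment> \<open>The rays of the initial cone are the tuples with exactly one gap, equal to 1, so
    the gaps of the set are the weights.\<close>
  define \<mu> where "\<mu> i = l ! Suc i - l ! i" for i
  have val: "map (dot \<mu>) (init m) = map (\<lambda>k. l ! (m - k) - l ! 0) [0..<m]"
    by (simp add: init_def dot_init \<mu>_def sum_lessThan_telescope)
  have "x \<in> (\<lambda>k. m - k) ` {..<m}" if "x < Suc m" "x \<noteq> 0" for x
    using that by (intro image_eqI[of _ _ "m - x"]) auto
  then have indices: "{..<Suc m} = insert 0 ((\<lambda>k. m - k) ` {..<m})"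
    by auto
  have "A = (!) l ` {..<Suc m}"
    using l(1,2) by (auto simp: set_conv_nth)
  also have "\<dots> = insert (l ! 0) ((\<lambda>k. l ! (m - k)) ` {..<m})"
    unfolding indices by (simp add: image_image)
  also have "\<dots> = (+) (l ! 0) ` insert 0 (set (map (dot \<mu>) (init m)))"
    unfolding val by (simp add: image_image atLeast0LessThan)
  finally have A_eq: "(+) (l ! 0) ` insert 0 (set (map (dot \<mu>) (init m))) = A"
    by (rule sym)
  have "\<exists>W' \<mu>'. terminal W' \<and> length W' = length (init m) \<and> map (dot \<mu>') W' = map (dot \<mu>) (init m)"
  proof (rule search_sound[OF assms(1) tame_init])
    show "\<forall>k<length (init m). 0 < gap (init m) m \<mu> k"
      using l(2) sorted_wrt_nth_less[OF l(3)] by (simp add: gap_init \<mu>_def)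
    show "mstd (insert 0 (set (map (dot \<mu>) (init m))))"
      using A(1) mstd_translate[of "l ! 0" "insert 0 (set (map (dot \<mu>) (init m)))"]
      by (simp only: A_eq)
    show "init m \<noteq> []"
      using m by (simp add: init_def)
  qed (use H in \<open>auto simp: vanishes_def\<close>)
  then obtain W' \<mu>' where "terminal W'" "length W' = m" "map (dot \<mu>') W' = map (dot \<mu>) (init m)"
    by auto
  then show ?thesis
    using A_eq by (intro exI[of _ W'] exI[of _ \<mu>'] exI[of _ "l ! 0"]) simp
qed

subsection \<open>Sets with at most eight elements\<close>

text \<open>Terminal lists have seven nonzero elements, so for smaller m a successful search has no
  survivors.\<close>

lemma no_mstd_step:
  assumes "search n (init m) []" "0 < m" "m < 7" "\<And>B :: real set. card B = m \<Longrightarrow> \<not> mstd B"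
    and "card (A :: real set) = Suc m"
  shows "\<not> mstd A"
proof
  assume "mstd A"
  then obtain W \<mu> a where W: "terminal W" "length W = m" "A = (+) (a :: real) ` insert 0 (set (map (dot \<mu>) W))"
    using mstd_of_search[OF assms(1,2,4)] assms(5) by blast
  have "length (map (dot \<mu>) W) = 7"
    using terminal_values[OF W(1), of \<mu>] W(2) assms(3) by auto
  then show False
    using W(2) assms(3) by simp
qed

lemma no_mstd_1:
  assumes "card (A :: real set) = 1"
  shows "\<not> mstd A"
proof -
  obtain a where "A = {a}"
    using assms by (rule card_1_singletonE)
  then show ?thesis
    by (simp add: mstd_def differences_def set_plus_def)
qed

lemma init_eval:
  "init 1 = [[1]]"
  "init 2 = [[1, 1], [1, 0]]"
  "init 3 = [[1, 1, 1], [1, 1, 0], [1, 0, 0]]"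
  "init 4 = [[1, 1, 1, 1], [1, 1, 1, 0], [1, 1, 0, 0], [1, 0, 0, 0]]"
  "init 5 = [[1, 1, 1, 1, 1], [1, 1, 1, 1, 0], [1, 1, 1, 0, 0], [1, 1, 0, 0, 0], [1, 0, 0, 0, 0]]"
  "init 6 = [[1, 1, 1, 1, 1, 1], [1, 1, 1, 1, 1, 0], [1, 1, 1, 1, 0, 0], [1, 1, 1, 0, 0, 0],
    [1, 1, 0, 0, 0, 0], [1, 0, 0, 0, 0, 0]]"
  "init 7 = [[1, 1, 1, 1, 1, 1, 1], [1, 1, 1, 1, 1, 1, 0], [1, 1, 1, 1, 1, 0, 0], [1, 1, 1, 1, 0, 0, 0],
    [1, 1, 1, 0, 0, 0, 0], [1, 1, 0, 0, 0, 0, 0], [1, 0, 0, 0, 0, 0, 0]]"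
  by (simp_all add: init_def eval_nat_numeral)

lemma depth_eval:
  "(8::nat) = Suc 7" "(7::nat) = Suc (Suc (Suc (Suc 3)))" "(3::nat) = Suc (Suc (Suc 0))" "(1::nat) = Suc 0"
  by simp_all

text \<open>The argument of \<open>init\<close> counts nonzero elements; these are the sets of sizes
  two to six.\<close>

lemma search_upto_6:
  "search 7 (init 1) []" "search 7 (init 2) []" "search 7 (init 3) []" "search 7 (init 4) []" "search 7 (init 5) []"
  unfolding init_eval by (simp_all only: depth_eval search_eval)

lemma search_7: "search 7 (init 6) []"
  unfolding init_eval by (simp only: depth_eval search_eval)

lemma no_mstd_upto_7:
  assumes "0 < m" "m \<le> 7" "card (A :: real set) = m"
  shows "\<not> mstd A"
proof -
  have "\<forall>A :: real set. card A = Suc m \<longrightarrow> \<not> mstd A"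
    if "\<forall>A :: real set. card A = m \<longrightarrow> \<not> mstd A" "0 < m" "m < 7" "search 7 (init m) []" for m
    using no_mstd_step[OF that(4,2,3)] that(1) by blast
  note step = this
  have 1: "\<forall>A :: real set. card A = 1 \<longrightarrow> \<not> mstd A"
    using no_mstd_1 by blast
  have 2: "\<forall>A :: real set. card A = 2 \<longrightarrow> \<not> mstd A"
    using step[OF 1] search_upto_6 by simp
  have 3: "\<forall>A :: real set. card A = 3 \<longrightarrow> \<not> mstd A"
    using step[OF 2] search_upto_6 by simp
  have 4: "\<forall>A :: real set. card A = 4 \<longrightarrow> \<not> mstd A"
    using step[OF 3] search_upto_6 by simp
  have 5: "\<forall>A :: real set. card A = 5 \<longrightarrow> \<not> mstd A"
    using step[OF 4] search_upto_6 by simp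
  have 6: "\<forall>A :: real set. card A = 6 \<longrightarrow> \<not> mstd A"
    using step[OF 5] search_upto_6 by simp
  have 7: "\<forall>A :: real set. card A = 7 \<longrightarrow> \<not> mstd A"
    using step[OF 6] search_7 by simp
  have "m \<in> {1, 2, 3, 4, 5, 6, 7}"
    using assms(1,2) by auto
  then show ?thesis
    using 1 2 3 4 5 6 7 assms(3) by auto
qed

text \<open>Lets the branches at the root be evaluated in separate lemmas, each starting with the
  equations excluded by the previous ones.\<close>

lemma search_all_append:
  "search_all f W (ds @ es) ns \<longleftrightarrow> search_all f W ds ns \<and> search_all f W es (rev ds @ ns)"
  by (induction ds arbitrary: ns) auto

definition first_cands :: "vec list" where
  "first_cands = the (branch (init 7) [])"

lemmas first_cands_eval =
  first_cands_def option.sel take_0 take_Suc_Cons drop_0 drop_Suc_Cons depth_eval search_eval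

lemma first_cands: "branch (init 7) [] = Some first_cands"
  unfolding first_cands_def init_eval by (simp only: first_cands_eval)

lemma search_8_part1: "search_all (search 7) (init 7) (take 3 first_cands) []"
  unfolding first_cands_def init_eval by (simp only: first_cands_eval)

lemma search_8_part2: "search_all (search 7) (init 7) (take 1 (drop 3 first_cands)) (rev (take 3 first_cands))"
  unfolding first_cands_def init_eval by (simp only: first_cands_eval)

lemma search_8_part3: "search_all (search 7) (init 7) (drop 1 (drop 3 first_cands))
    (rev (take 1 (drop 3 first_cands)) @ rev (take 3 first_cands))"
  unfolding first_cands_def init_eval by (simp only: first_cands_eval)

lemma search_8: "search 8 (init 7) []"
proof -
  have "search_all (search 7) (init 7) first_cands []"
    using search_8_part1 search_8_part2 search_8_part3
      search_all_append[of "search 7" "init 7" "take 3 first_cands" "drop 3 first_cands" "[]"]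
      search_all_append[of "search 7" "init 7" "take 1 (drop 3 first_cands)" "drop 1 (drop 3 first_cands)"
        "rev (take 3 first_cands)"]
    by (simp only: append_take_drop_id append_Nil2)
  moreover have "search 8 (init 7) [] = search_all (search 7) (init 7) first_cands []"
    unfolding depth_eval(1) by (simp only: search.simps first_cands option.case)
  ultimately show ?thesis
    by simp
qed

section \<open>Back to sets of integers\<close>

lemma card_of_int: "card (real_of_int ` B) = card B"
  by (rule card_image) (simp add: inj_on_def)

lemma mstd_of_int: "MSTD A \<Longrightarrow> mstd (real_of_int ` A)"
proof -
  assume A: "MSTD A"
  have "real_of_int ` A + real_of_int ` A = real_of_int ` (A + A)"
    unfolding set_plus_image pair_image image_image by (intro image_cong) auto
  moreover have "differences (real_of_int ` A) = real_of_int ` diffset A A"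
    by (force simp: differences_iff diffset_def)
  ultimately show ?thesis
    using A by (simp add: mstd_def MSTD_def card_of_int)
qed

lemma mstd_8:
  assumes "card A = 8" "MSTD A"
  shows "\<exists>u v :: int. u \<noteq> 0 \<and> A = {u * a + v | a. a \<in> A1}"
proof -
  have "card (real_of_int ` A) = Suc 7"
    using assms(1) by (simp add: card_of_int)
  then obtain W \<mu> and a :: real where W: "terminal W" "length W = 7"
    "real_of_int ` A = (+) a ` insert 0 (set (map (dot \<mu>) W))"
    using mstd_of_search[OF search_8 _ _ mstd_of_int[OF assms(2)]] no_mstd_upto_7[of 7] by auto
  obtain t K where t: "map (dot \<mu>) W = map (\<lambda>k. of_int k * t) K"
    "K = [14, 12, 11, 7, 4, 3, 2] \<or> K = [14, 12, 11, 10, 7, 3, 2]"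
    using terminal_values[OF W(1) eq_imp_le[OF W(2)], of \<mu>] by blast
  have A: "real_of_int ` A = (\<lambda>k. a + of_int k * t) ` insert 0 (set K)"
    unfolding W(3) t(1) by (simp add: image_image)
  \<comment> \<open>Both lists contain 2 and 3 besides 0: a, a + 2t and a + 3t are integers, hence
    so is their step t.\<close>
  have "{0, 2, 3} \<subseteq> insert 0 (set K)"
    using t(2) by auto
  then have "a + of_int 0 * t \<in> real_of_int ` A" "a + of_int 2 * t \<in> real_of_int ` A"
    "a + of_int 3 * t \<in> real_of_int ` A"
    unfolding A by blast+
  then obtain v p q :: int where v: "a = of_int v" and "a + 2 * t = of_int p" "a + 3 * t = of_int q"
    by auto
  then have u: "t = of_int (q - p)"
    by simp
  define u where "u = q - p"
  have "real_of_int ` A = real_of_int ` (\<lambda>k. v + k * u) ` insert 0 (set K)"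
    unfolding A image_image by (intro image_cong) (auto simp: v u u_def)
  then have A_eq: "A = (\<lambda>k. v + k * u) ` insert 0 (set K)"
    by (rule iffD1[OF inj_image_eq_iff, rotated]) (simp add: inj_on_def)
  have "u \<noteq> 0"
  proof
    assume "u = 0"
    then have "A = {v}"
      unfolding A_eq by auto
    then show False
      using assms(1) by simp
  qed
  from t(2) show ?thesis
  proof
    assume K: "K = [14, 12, 11, 7, 4, 3, 2]"
    have "A = (\<lambda>a. u * a + v) ` A1"
      unfolding A_eq K A1_def by (auto simp: algebra_simps)
    also have "\<dots> = {u * a + v | a. a \<in> A1}"
      by blast
    finally have "A = {u * a + v | a. a \<in> A1}" .
    then show ?thesis
      using \<open>u \<noteq> 0\<close> by blast
  next
    assume K: "K = [14, 12, 11, 10, 7, 3, 2]"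
    \<comment> \<open>This list belongs to 14 - \<open>A1\<close>; substituting k = 14 - a into v +
      k u yields the slope -u and the offset v + 14 u.\<close>
    have "A = (\<lambda>a. (- u) * a + (v + 14 * u)) ` A1"
      unfolding A_eq K A1_def by (auto simp: algebra_simps)
    also have "\<dots> = {(- u) * a + (v + 14 * u) | a. a \<in> A1}"
      by blast
    finally have "A = {(- u) * a + (v + 14 * u) | a. a \<in> A1}" .
    then show ?thesis
      using \<open>u \<noteq> 0\<close> by (intro exI[of _ "- u"] exI[of _ "v + 14 * u"]) simp
  qed
qed

theorem theorem1:
  shows "(\<nexists>A :: int set. card A = 7 \<and> MSTD A) \<and>
    (\<forall>A :: int set. card A = 8 \<and> MSTD A \<longrightarrow>
      (\<exists>u v :: int. u \<noteq> 0 \<and> A = {u * a + v | a. a \<in> A1}))"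
proof -
  have "\<not> MSTD A" if "card A = 7" for A :: "int set"
    using mstd_of_int[of A] no_mstd_upto_7[of 7 "real_of_int ` A"] that by (auto simp: card_of_int)
  then show ?thesis
    using mstd_8 by blast
qed

end
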